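(* Consider all pairs $(G,M)$ where $G$ is a nontrivial elementary abelian $2$-group and $M=(M_{x,y})_{x,y\in G}$ is a $\{1,-1\}$-matrix such that for all $x,y,z\in G$ with $x\neq y$, \[ M_{x,xz}\,M_{x,yz}\,M_{y,xz}\,M_{y,yz}=-1 ,\] and let $S(G,M)$ be the Jordan scheme on $4|G|$ points constructed from $(G,M)$ as in the context. Then, up to combinatorial isomorphism, exactly three Jordan schemes arise as $S(G,M)$; they have orders (numbers of points) $8$, $16$ and $32$, corresponding to $|G|=2,4,8$ respectively. In particular, any two Jordan schemes $S(G,M)$ and $S(G',M')$ with $|G|=|G'|$ are combinatorially isomorphic. The Jordan scheme of order $8$ is improper, whereas those of orders $16$ and $32$ are proper.
   Context: Jordan product: for square matrices $A,B$ of the same order, $A*B:=\frac{1}{2}(AB+BA)$. Jordan scheme: let $X$ be a finite set and let $S=\{A_0=I,A_1,\dots,A_d\}\subset M_X(\mathbb{C})$ be a set of symmetric $\{0,1\}$-matrices. $(X,S)$ is a Jordan scheme if (1) $\sum_{i=0}^d A_i=J$, the all-one matrix, and (2) there exist $p_{ij}^k\in\frac12\mathbb{Z}$ such that $A_i*A_j=\sum_{k=0}^d p_{ij}^kA_k$ for all $i,j$. Its order is $|X|$. Association scheme: a pair $(X,S)$ with $S=\{A_0=I,A_1,\dots,A_d\}\subset M_X(\mathbb{C})$ a set of $\{0,1\}$-matrices such that $\sum_i A_i=J$, the transpose of each element of $S$ lies in $S$, and there are non-negative integers $p_{ij}^k$ with $A_iA_j=\sum_k p_{ij}^kA_k$ for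 all $i,j$. It need not be commutative. Symmetrization: for an association scheme $(X,S)$ and $A\in S$, let $\tilde A=A$ if $A$ is symmetric and $\tilde A=A+{}^tA$ otherwise; the symmetrization of $(X,S)$ is $(X,\tilde S)$ with $\tilde S=\{\tilde A: A\in S\}$, which is always a Jordan scheme. A Jordan scheme is improper if it is the symmetrization of some association scheme, and proper otherwise. Combinatorial isomorphism: Jordan schemes $(X,S)$ and $(X',S')$ are combinatorially isomorphic if there is a bijection $X\to X'$ which, by relabeling rows and columns, carries the set of matrices $S$ onto the set $S'$. Construction of $S(G,M)$: let $I_2$ and $J_2$ be the identity and all-one matrices of order $2$, $K_2=J_2-I_2$, $C_2=\langle h\rangle$ the group of order $2$, $H=C_2\times G$, and $E_{(s,t),(u,v)}$ the matrix units of $M_H(\mathbb{C})$. For $(s,t)\in H$ and $x,y\in G$ put \[ L_{x,y}=L^{(s,t)}_{x,y}:=\begin{cases} I_2 & \text{if } s=1,\ t=1,\\ J_2 & \text{if } s=1,\ t\neq 1,\\ I_2 & \text{if } s\neq 1 \text{ and } M_{x,y}=1,\\ K_2 & \text{if } s\neq 1\text{ and } M_{x,y}=-1,\end{cases}\] \[\sigma_{(s,t)}:=\sum_{g\in G}E_{(1,g),(s,gt)}\otimes L_{g,gt}+\sum_{g\in G}E_{(h,g),(hs,gt)}\otimes L_{gt,g},\] and let $\sigma'_{(s,t)}$ be the same expression with $L_{g,gt}$ and $L_{gt,g}$ replaced by $L_{g,gt}K_2$ and $L_{gt,g}K_2$ respectively. Then \[ S(G,M):=\{\sigma_{(1,1)},\sigma_{(1,1)}'\}\cup\{\sigma_{(1,t)}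 : t\in G,\ t\neq 1\}\cup\{\sigma_{(h,t)},\sigma_{(h,t)}' : t\in G\},\] a set of matrices of degree $4|G|$, which is a Jordan scheme. *)

theory Defs
  imports Complex_Main "HOL-Algebra.Elementary_Groups"
begin

text \<open>
  A complex matrix with rows and columns indexed by a finite set \<open>X\<close> is a function of two
  arguments that vanishes outside \<open>X \<times> X\<close>, so that equality of such functions is equality of
  matrices.
\<close>

type_synonym 'x cmatrix = "'x \<Rightarrow> 'x \<Rightarrow> complex"

definition matrices :: "'x set \<Rightarrow> 'x cmatrix set" where
  "matrices X = {A. \<forall>x y. A x y \<noteq> 0 \<longrightarrow> x \<in> X \<and> y \<in> X}"

definition zero_one_matrices :: "'x set \<Rightarrow> 'x cmatrix set" where
  "zero_one_matrices X = {A \<in> matrices X. \<forall>x y. A x y \<in> {0, 1}}"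

definition identity_matrix :: "'x set \<Rightarrow> 'x cmatrix" where
  "identity_matrix X = (\<lambda>x y. if x \<in> X \<and> x = y then 1 else 0)"

definition all_one_matrix :: "'x set \<Rightarrow> 'x cmatrix" where
  "all_one_matrix X = (\<lambda>x y. if x \<in> X \<and> y \<in> X then 1 else 0)"

definition matrix_unit :: "'x \<Rightarrow> 'x \<Rightarrow> 'x cmatrix" where
  "matrix_unit a b = (\<lambda>x y. if x = a \<and> y = b then 1 else 0)"

definition transpose_matrix :: "'x cmatrix \<Rightarrow> 'x cmatrix" where
  "transpose_matrix A = (\<lambda>x y. A y x)"

definition matrix_add :: "'x cmatrix \<Rightarrow> 'x cmatrix \<Rightarrow> 'x cmatrix" where
  "matrix_add A B = (\<lambda>x y. A x y + B x y)"

definition matrix_mult :: "'x set \<Rightarrow> 'x cmatrix \<Rightarrow> 'x cmatrix \<Rightarrow> 'x cmatrix" where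
  "matrix_mult X A B = (\<lambda>x y. \<Sum>z\<in>X. A x z * B z y)"

definition jordan_mult :: "'x set \<Rightarrow> 'x cmatrix \<Rightarrow> 'x cmatrix \<Rightarrow> 'x cmatrix" where
  "jordan_mult X A B = (\<lambda>x y. 1/2 * (matrix_mult X A B x y + matrix_mult X B A x y))"

definition kronecker :: "'x cmatrix \<Rightarrow> 'y cmatrix \<Rightarrow> ('x \<times> 'y) cmatrix" where
  "kronecker A B = (\<lambda>(x, i) (y, j). A x y * B i j)"

definition half_integers :: "complex set" where
  "half_integers = {of_int m / 2 | m. True}"


subsection \<open>Jordan schemes and association schemes\<close>

definition jordan_scheme :: "'x set \<Rightarrow> 'x cmatrix set \<Rightarrow> bool" where
  "jordan_scheme X S \<longleftrightarrow>
     finite X \<and> finite S \<and> S \<subseteq> zero_one_matrices X \<and> identity_matrix X \<in> S \<and>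
     (\<forall>A\<in>S. transpose_matrix A = A) \<and>
     (\<lambda>x y. \<Sum>A\<in>S. A x y) = all_one_matrix X \<and>
     (\<exists>p. (\<forall>A\<in>S. \<forall>B\<in>S. \<forall>C\<in>S. p A B C \<in> half_integers) \<and>
          (\<forall>A\<in>S. \<forall>B\<in>S. jordan_mult X A B = (\<lambda>x y. \<Sum>C\<in>S. p A B C * C x y)))"

definition association_scheme :: "'x set \<Rightarrow> 'x cmatrix set \<Rightarrow> bool" where
  "association_scheme X S \<longleftrightarrow>
     finite X \<and> finite S \<and> S \<subseteq> zero_one_matrices X \<and> identity_matrix X \<in> S \<and>
     (\<lambda>x y. \<Sum>A\<in>S. A x y) = all_one_matrix X \<and>
     (\<forall>A\<in>S. transpose_matrix A \<in> S) \<and>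
     (\<exists>p. (\<forall>A\<in>S. \<forall>B\<in>S. \<forall>C\<in>S. p A B C \<in> \<nat>) \<and>
          (\<forall>A\<in>S. \<forall>B\<in>S. matrix_mult X A B = (\<lambda>x y. \<Sum>C\<in>S. p A B C * C x y)))"

definition symmetrize :: "'x cmatrix \<Rightarrow> 'x cmatrix" where
  "symmetrize A =
     (if transpose_matrix A = A then A else matrix_add A (transpose_matrix A))"

definition improper_jordan_scheme :: "'x set \<Rightarrow> 'x cmatrix set \<Rightarrow> bool" where
  "improper_jordan_scheme X S \<longleftrightarrow>
     jordan_scheme X S \<and> (\<exists>T. association_scheme X T \<and> S = symmetrize ` T)"

definition proper_jordan_scheme :: "'x set \<Rightarrow> 'x cmatrix set \<Rightarrow> bool" where
  "proper_jordan_scheme X S \<longleftrightarrow> jordan_scheme X S \<and> \<not> improper_jordan_scheme X S"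

definition relabel :: "'x set \<Rightarrow> 'y set \<Rightarrow> ('x \<Rightarrow> 'y) \<Rightarrow> 'x cmatrix \<Rightarrow> 'y cmatrix" where
  "relabel X Y f A =
     (\<lambda>u v. if u \<in> Y \<and> v \<in> Y then A (inv_into X f u) (inv_into X f v) else 0)"

definition combinatorially_isomorphic ::
  "'x set \<Rightarrow> 'x cmatrix set \<Rightarrow> 'y set \<Rightarrow> 'y cmatrix set \<Rightarrow> bool" where
  "combinatorially_isomorphic X S Y T \<longleftrightarrow>
     (\<exists>f. bij_betw f X Y \<and> relabel X Y f ` S = T)"


subsection \<open>The pairs \<open>(G, M)\<close>\<close>

definition elementary_abelian_2_group :: "('a, 'm) monoid_scheme \<Rightarrow> bool" where
  "elementary_abelian_2_group G \<longleftrightarrow>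
     comm_group G \<and> finite (carrier G) \<and> (\<forall>x\<in>carrier G. x \<otimes>\<^bsub>G\<^esub> x = \<one>\<^bsub>G\<^esub>)"

definition admissible_pair :: "('a, 'm) monoid_scheme \<Rightarrow> ('a \<Rightarrow> 'a \<Rightarrow> int) \<Rightarrow> bool" where
  "admissible_pair G M \<longleftrightarrow>
     elementary_abelian_2_group G \<and> carrier G \<noteq> {\<one>\<^bsub>G\<^esub>} \<and>
     (\<forall>x\<in>carrier G. \<forall>y\<in>carrier G. M x y \<in> {1, -1}) \<and>
     (\<forall>x\<in>carrier G. \<forall>y\<in>carrier G. \<forall>z\<in>carrier G. x \<noteq> y \<longrightarrow>
        M x (x \<otimes>\<^bsub>G\<^esub> z) * M x (y \<otimes>\<^bsub>G\<^esub> z) * M y (x \<otimes>\<^bsub>G\<^esub> z) * M y (y \<otimes>\<^bsub>G\<^esub> z) = -1)"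


subsection \<open>The construction \<open>S(G, M)\<close>\<close>

text \<open>
  The group of order 2 is the additive group of integers modulo 2, so its identity is \<open>0\<close> and
  its generator is \<open>1\<close>.
\<close>

abbreviation C2 :: "int monoid" where
  "C2 \<equiv> integer_mod_group 2"

abbreviation (input) C2_gen :: int where
  "C2_gen \<equiv> 1"

abbreviation two_set :: "nat set" where
  "two_set \<equiv> {0, 1}"

definition I2 :: "nat cmatrix" where
  "I2 = identity_matrix two_set"

definition J2 :: "nat cmatrix" where
  "J2 = all_one_matrix two_set"

definition K2 :: "nat cmatrix" where
  "K2 = (\<lambda>i j. J2 i j - I2 i j)"

definition L_block ::
  "('a, 'm) monoid_scheme \<Rightarrow> ('a \<Rightarrow> 'a \<Rightarrow> int) \<Rightarrow> int \<Rightarrow> 'a \<Rightarrow> 'a \<Rightarrow> 'a \<Rightarrow> nat cmatrix" where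
  "L_block G M s t x y =
     (if s = \<one>\<^bsub>C2\<^esub> then (if t = \<one>\<^bsub>G\<^esub> then I2 else J2)
      else (if M x y = 1 then I2 else K2))"

definition block_sum ::
  "('a, 'm) monoid_scheme \<Rightarrow> int \<Rightarrow> 'a \<Rightarrow> ('a \<Rightarrow> 'a \<Rightarrow> nat cmatrix) \<Rightarrow> ((int \<times> 'a) \<times> nat) cmatrix"
  where
  "block_sum G s t L = (\<lambda>p q.
     (\<Sum>g\<in>carrier G.
        kronecker (matrix_unit (\<one>\<^bsub>C2\<^esub>, g) (s, g \<otimes>\<^bsub>G\<^esub> t)) (L g (g \<otimes>\<^bsub>G\<^esub> t)) p q) +
     (\<Sum>g\<in>carrier G.
        kronecker (matrix_unit (C2_gen, g) (C2_gen \<otimes>\<^bsub>C2\<^esub> s, g \<otimes>\<^bsub>G\<^esub> t)) (L (g \<otimes>\<^bsub>G\<^esub> t) g) p q))"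

definition sigma ::
  "('a, 'm) monoid_scheme \<Rightarrow> ('a \<Rightarrow> 'a \<Rightarrow> int) \<Rightarrow> int \<Rightarrow> 'a \<Rightarrow> ((int \<times> 'a) \<times> nat) cmatrix" where
  "sigma G M s t = block_sum G s t (L_block G M s t)"

definition sigma' ::
  "('a, 'm) monoid_scheme \<Rightarrow> ('a \<Rightarrow> 'a \<Rightarrow> int) \<Rightarrow> int \<Rightarrow> 'a \<Rightarrow> ((int \<times> 'a) \<times> nat) cmatrix" where
  "sigma' G M s t =
     block_sum G s t (\<lambda>x y. matrix_mult two_set (L_block G M s t x y) K2)"

definition scheme_points :: "('a, 'm) monoid_scheme \<Rightarrow> ((int \<times> 'a) \<times> nat) set" where
  "scheme_points G = carrier (C2 \<times>\<times> G) \<times> two_set"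

definition scheme_matrices ::
  "('a, 'm) monoid_scheme \<Rightarrow> ('a \<Rightarrow> 'a \<Rightarrow> int) \<Rightarrow> ((int \<times> 'a) \<times> nat) cmatrix set" where
  "scheme_matrices G M =
     {sigma G M \<one>\<^bsub>C2\<^esub> \<one>\<^bsub>G\<^esub>, sigma' G M \<one>\<^bsub>C2\<^esub> \<one>\<^bsub>G\<^esub>} \<union>
     {sigma G M \<one>\<^bsub>C2\<^esub> t | t. t \<in> carrier G \<and> t \<noteq> \<one>\<^bsub>G\<^esub>} \<union>
     ({sigma G M C2_gen t | t. t \<in> carrier G} \<union> {sigma' G M C2_gen t | t. t \<in> carrier G})"

text \<open>
  Every finite group is isomorphic to one whose carrier is a set of natural numbers, so all
  pairs \<open>(G, M)\<close> are represented, up to renaming of the elements of \<open>G\<close>, with \<open>G\<close> on \<open>nat\<close>.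
\<close>

definition arising_schemes ::
  "(((int \<times> nat) \<times> nat) set \<times> ((int \<times> nat) \<times> nat) cmatrix set) set" where
  "arising_schemes =
     {(scheme_points G, scheme_matrices G M) | (G :: nat monoid) M. admissible_pair G M}"

definition combinatorial_isomorphism_rel ::
  "(('x set \<times> 'x cmatrix set) \<times> ('x set \<times> 'x cmatrix set)) set" where
  "combinatorial_isomorphism_rel =
     {((X, S), (Y, T)). combinatorially_isomorphic X S Y T}"

end

theory Submission
  imports Defs
begin

text \<open>
  A point \<open>((s, g), i)\<close> has a side \<open>s\<close>, a position \<open>g\<close> and a last coordinate \<open>i\<close>. All classes of
  \<open>S(G, M)\<close> are made from two kinds of involutions: \<open>swap\<close>, which changes \<open>i\<close>, and for every \<open>t\<close> in
  \<open>G\<close> the map \<open>cross t\<close>, which changes the side and has permutation matrix \<open>\<sigma>\<close> at \<open>(h, t)\<close>. The swap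
  commutes with every crossing, and the condition on \<open>M\<close> says precisely that two different
  crossings anticommute, in the sense that exchanging them costs a swap at every point
  (\<open>cross_anticommute\<close>). The Jordan property follows at once, because the two products of two
  different crossings add up to a class of valency 2.

  The condition on \<open>M\<close>, read additively, prescribes the mixed second differences of a function of
  two variables. After normalization such a function has associator 1 on all independent triples
  (\<open>normalized_associator\<close>). Four independent elements would make the five terms of the pentagon
  identity all equal to 1, although their sum is 0 (\<open>no_fourth_generator\<close>); hence \<open>G\<close> has order 2, 4
  or 8. The signs of complex, quaternion and octonion multiplication are solutions. Two solutions
  on the same group differ by a symmetric 2-cocycle up to functions of one variable, and that
  cocycle is a coboundary (\<open>second_difference_coboundary\<close>); all these modifications are realised by
  relabelling points (\<open>schemes_isomorphic\<close>).

  In an association scheme that symmetrizes to \<open>S(G, M)\<close> every crossing is a class, and classes of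
  valency 1 are closed under multiplication. A product of three different crossings exchanges the
  sides, which forces it to be an involution, but its square is the swap. So three crossings, that
  is, a group of order at least 4, exclude an association scheme (\<open>proper_scheme\<close>). For order 2, the
  two crossings and the swap generate a dihedral group of order 8 that acts regularly
  (\<open>improper_scheme\<close>).
\<close>

section \<open>Elementary abelian 2-groups\<close>

locale elementary_2_group = comm_group G for G (structure) +
  assumes finite_carrier: "finite (carrier G)"
    and square: "x \<in> carrier G \<Longrightarrow> x \<otimes> x = \<one>"
begin

lemma square_left: "x \<in> carrier G \<Longrightarrow> y \<in> carrier G \<Longrightarrow> x \<otimes> (x \<otimes> y) = y"
  by (metis l_one m_assoc square)

lemmas ac = m_ac square square_left

lemma shift_iff:
  assumes "x \<in> carrier G" "y \<in> carrier G" "t \<in> carrier G"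
  shows "y = x \<otimes> t \<longleftrightarrow> t = x \<otimes> y"
  using assms by (auto simp: ac)

lemma mult_eq_one_iff:
  assumes "x \<in> carrier G" "y \<in> carrier G"
  shows "x \<otimes> y = \<one> \<longleftrightarrow> x = y"
  using assms shift_iff [of x \<one> y] by (auto simp: square)

lemma fixed_iff:
  assumes "x \<in> carrier G" "t \<in> carrier G"
  shows "x = x \<otimes> t \<longleftrightarrow> t = \<one>"
  using shift_iff [of x x t] assms by (simp add: square)

lemma inv_self: "x \<in> carrier G \<Longrightarrow> inv x = x"
  using inv_unique' square by metis

definition adjoin :: "'a \<Rightarrow> 'a set \<Rightarrow> 'a set" where
  "adjoin e H = H \<union> (\<lambda>h. e \<otimes> h) ` H"

lemma subgroup_adjoin:
  assumes "subgroup H G" "e \<in> carrier G"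
  shows "subgroup (adjoin e H) G"
proof (rule subgroupI)
  interpret H: subgroup H G by fact
  show "adjoin e H \<subseteq> carrier G"
    using assms by (auto simp: adjoin_def)
  show "adjoin e H \<noteq> {}"
    using H.one_closed unfolding adjoin_def by blast
  show "inv a \<in> adjoin e H" if "a \<in> adjoin e H" for a
    using that \<open>adjoin e H \<subseteq> carrier G\<close> inv_self by (metis subsetD)
  fix a b assume "a \<in> adjoin e H" "b \<in> adjoin e H"
  then obtain h k where hk: "h \<in> H" "k \<in> H" "a = h \<or> a = e \<otimes> h" "b = k \<or> b = e \<otimes> k"
    by (auto simp: adjoin_def)
  moreover have "h \<otimes> k \<in> H" "h \<in> carrier G" "k \<in> carrier G"
    using hk by auto
  ultimately have "a \<otimes> b = h \<otimes> k \<or> a \<otimes> b = e \<otimes> (h \<otimes> k)"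
    using assms(2) by (auto simp: ac)
  then show "a \<otimes> b \<in> adjoin e H"
    using \<open>h \<otimes> k \<in> H\<close> by (auto simp: adjoin_def)
qed

lemma coset_disjoint:
  assumes "subgroup H G" "e \<in> carrier G" "e \<notin> H" "h \<in> H"
  shows "e \<otimes> h \<notin> H"
proof
  interpret H: subgroup H G by fact
  assume "e \<otimes> h \<in> H"
  then have "(e \<otimes> h) \<otimes> h \<in> H" using assms by blast
  moreover have "(e \<otimes> h) \<otimes> h = e" using assms by (simp add: ac)
  ultimately show False using assms by simp
qed

lemma card_adjoin:
  assumes "subgroup H G" "e \<in> carrier G" "e \<notin> H"
  shows "card (adjoin e H) = 2 * card H"
proof -
  interpret H: subgroup H G by fact
  have fin: "finite H" using finite_carrier finite_subset H.subset by blast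
  have "inj_on (\<lambda>h. e \<otimes> h) H"
    using assms by (auto simp: inj_on_def)
  moreover have "H \<inter> (\<lambda>h. e \<otimes> h) ` H = {}"
    using coset_disjoint [OF assms] by auto
  ultimately show ?thesis
    using fin by (simp add: adjoin_def card_Un_disjoint card_image)
qed

text \<open>
  Adjoining one generator at a time reaches the whole group. Isomorphisms, coboundaries and the
  bound on the order are all built along such a chain, which replaces a choice of coordinates.
\<close>

lemma subgroup_induct [consumes 0, case_names trivial adjoin]:
  assumes trivial: "P {\<one>}"
    and step: "\<And>H e. subgroup H G \<Longrightarrow> e \<in> carrier G \<Longrightarrow> e \<notin> H \<Longrightarrow> P H \<Longrightarrow> P (adjoin e H)"
  shows "P (carrier G)"
proof -
  have "P (carrier G)" if "subgroup H G" "P H" for H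
    using that
  proof (induction "card (carrier G - H)" arbitrary: H rule: less_induct)
    case less
    show ?case
    proof (cases "carrier G \<subseteq> H")
      case True
      then show ?thesis
        using less.prems subgroup.subset [of H G] by (metis subset_antisym)
    next
      case False
      then obtain e where e: "e \<in> carrier G" "e \<notin> H" by blast
      interpret H: subgroup H G by (rule less.prems)
      have "e = e \<otimes> \<one>" using e by simp
      then have "e \<in> adjoin e H" using H.one_closed unfolding adjoin_def by blast
      then have "carrier G - adjoin e H \<subset> carrier G - H"
        using e by (auto simp: adjoin_def)
      then have "card (carrier G - adjoin e H) < card (carrier G - H)"
        using finite_carrier by (simp add: psubset_card_mono)
      then show ?thesis
        using less e subgroup_adjoin step by blast
    qed
  qed
  then show ?thesis
    using triv_subgroup trivial by blast
qed

end

lemma elementary_2_group_iff: "elementary_abelian_2_group G \<longleftrightarrow> elementary_2_group G"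
  by (auto simp: elementary_abelian_2_group_def elementary_2_group_def elementary_2_group_axioms_def)

text \<open>
  An injective homomorphism on a proper subgroup misses some element of the target, because the
  orders agree; sending the next generator there keeps it injective.
\<close>

lemma elementary_2_group_iso:
  fixes G :: "('a, 'm) monoid_scheme" and G' :: "('b, 'n) monoid_scheme"
  assumes "elementary_2_group G" "elementary_2_group G'" "order G = order G'"
  obtains f where "bij_betw f (carrier G) (carrier G')"
    "\<forall>x\<in>carrier G. \<forall>y\<in>carrier G. f (x \<otimes>\<^bsub>G\<^esub> y) = f x \<otimes>\<^bsub>G'\<^esub> f y"
proof -
  interpret G: elementary_2_group G by fact
  interpret G': elementary_2_group G' by fact
  define P where "P H \<longleftrightarrow> (\<exists>f. f ` H \<subseteq> carrier G' \<and> inj_on f H \<and>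
    (\<forall>x\<in>H. \<forall>y\<in>H. f (x \<otimes>\<^bsub>G\<^esub> y) = f x \<otimes>\<^bsub>G'\<^esub> f y))" for H
  have "P (carrier G)"
  proof (induction rule: G.subgroup_induct)
    case trivial
    show ?case
      unfolding P_def by (rule exI [of _ "\<lambda>_. \<one>\<^bsub>G'\<^esub>"]) auto
  next
    case (adjoin H e)
    then obtain f where f: "f ` H \<subseteq> carrier G'" "inj_on f H"
      "\<And>x y. x \<in> H \<Longrightarrow> y \<in> H \<Longrightarrow> f (x \<otimes>\<^bsub>G\<^esub> y) = f x \<otimes>\<^bsub>G'\<^esub> f y"
      unfolding P_def by blast
    interpret H: subgroup H G by fact
    have "H \<subset> carrier G" using adjoin H.subset by blast
    then have "card H < card (carrier G)"
      using G.finite_carrier psubset_card_mono by blast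
    then have "card (f ` H) < card (carrier G')"
      using assms(3) card_image [OF f(2)] by (simp add: order_def)
    then obtain e' where e': "e' \<in> carrier G'" "e' \<notin> f ` H"
      using f(1) by (metis less_irrefl subset_antisym subsetI)
    have fc: "f h \<in> carrier G'" if "h \<in> H" for h using f(1) that by blast
    have hc: "h \<in> carrier G" if "h \<in> H" for h using that by simp
    have coset: "e \<otimes>\<^bsub>G\<^esub> h \<notin> H" if "h \<in> H" for h
      using G.coset_disjoint adjoin that by blast
    have coset': "e' \<otimes>\<^bsub>G'\<^esub> f h \<noteq> f k" if "h \<in> H" "k \<in> H" for h k
    proof
      assume eq: "e' \<otimes>\<^bsub>G'\<^esub> f h = f k"
      have "e' = (e' \<otimes>\<^bsub>G'\<^esub> f h) \<otimes>\<^bsub>G'\<^esub> f h" using that fc e' by (simp add: G'.ac)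
      also have "\<dots> = f (k \<otimes>\<^bsub>G\<^esub> h)" using eq f(3) that by simp
      finally show False using e' that by blast
    qed
    define g where "g x = (if x \<in> H then f x else e' \<otimes>\<^bsub>G'\<^esub> f (e \<otimes>\<^bsub>G\<^esub> x))" for x
    have g0: "g h = f h" if "h \<in> H" for h using that by (simp add: g_def)
    have g1: "g (e \<otimes>\<^bsub>G\<^esub> h) = e' \<otimes>\<^bsub>G'\<^esub> f h" if "h \<in> H" for h
      using coset [OF that] hc [OF that] adjoin by (simp add: g_def G.square_left)
    have "g ` G.adjoin e H \<subseteq> carrier G'"
      using g0 g1 fc e' by (auto simp: G.adjoin_def)
    moreover have "inj_on g (G.adjoin e H)"
    proof (rule inj_onI)
      fix x y assume xy: "x \<in> G.adjoin e H" "y \<in> G.adjoin e H" and eq: "g x = g y"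
      obtain h k where hk: "h \<in> H" "k \<in> H" "x = h \<or> x = e \<otimes>\<^bsub>G\<^esub> h" "y = k \<or> y = e \<otimes>\<^bsub>G\<^esub> k"
        using xy by (auto simp: G.adjoin_def)
      show "x = y"
        using hk(3,4) eq g0 [OF hk(1)] g0 [OF hk(2)] g1 [OF hk(1)] g1 [OF hk(2)]
          coset' [OF hk(1,2)] coset' [OF hk(2,1)] inj_onD [OF f(2) _ hk(1,2)] fc [OF hk(1)] fc [OF hk(2)] e'
        by (elim disjE) simp_all
    qed
    moreover have "g (x \<otimes>\<^bsub>G\<^esub> y) = g x \<otimes>\<^bsub>G'\<^esub> g y"
      if xy: "x \<in> G.adjoin e H" "y \<in> G.adjoin e H" for x y
    proof -
      obtain h k where hk: "h \<in> H" "k \<in> H" "x = h \<or> x = e \<otimes>\<^bsub>G\<^esub> h" "y = k \<or> y = e \<otimes>\<^bsub>G\<^esub> k"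
        using xy by (auto simp: G.adjoin_def)
      have hkH: "h \<otimes>\<^bsub>G\<^esub> k \<in> H" using hk by blast
      have e1: "h \<otimes>\<^bsub>G\<^esub> (e \<otimes>\<^bsub>G\<^esub> k) = e \<otimes>\<^bsub>G\<^esub> (h \<otimes>\<^bsub>G\<^esub> k)"
        "(e \<otimes>\<^bsub>G\<^esub> h) \<otimes>\<^bsub>G\<^esub> k = e \<otimes>\<^bsub>G\<^esub> (h \<otimes>\<^bsub>G\<^esub> k)"
        "(e \<otimes>\<^bsub>G\<^esub> h) \<otimes>\<^bsub>G\<^esub> (e \<otimes>\<^bsub>G\<^esub> k) = h \<otimes>\<^bsub>G\<^esub> k"
        using hk adjoin by (simp_all add: G.ac hc)
      have e2: "f h \<otimes>\<^bsub>G'\<^esub> (e' \<otimes>\<^bsub>G'\<^esub> f k) = e' \<otimes>\<^bsub>G'\<^esub> (f h \<otimes>\<^bsub>G'\<^esub> f k)"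
        "(e' \<otimes>\<^bsub>G'\<^esub> f h) \<otimes>\<^bsub>G'\<^esub> f k = e' \<otimes>\<^bsub>G'\<^esub> (f h \<otimes>\<^bsub>G'\<^esub> f k)"
        "(e' \<otimes>\<^bsub>G'\<^esub> f h) \<otimes>\<^bsub>G'\<^esub> (e' \<otimes>\<^bsub>G'\<^esub> f k) = f h \<otimes>\<^bsub>G'\<^esub> f k"
        using hk e' by (simp_all add: G'.ac fc)
      show ?thesis
        using hk(3,4) by (elim disjE) (simp_all add: e1 e2 g0 g1 hk hkH f(3))
    qed
    ultimately show ?case
      unfolding P_def by blast
  qed
  then obtain f where f: "f ` carrier G \<subseteq> carrier G'" "inj_on f (carrier G)"
      "\<And>x y. x \<in> carrier G \<Longrightarrow> y \<in> carrier G \<Longrightarrow> f (x \<otimes>\<^bsub>G\<^esub> y) = f x \<otimes>\<^bsub>G'\<^esub> f y"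
    unfolding P_def by blast
  have "f ` carrier G = carrier G'"
    using f assms(3) by (intro card_subset_eq [OF G'.finite_carrier]) (auto simp: card_image order_def)
  then show thesis using that f by (auto simp: bij_betw_def)
qed

section \<open>Functions with prescribed second differences\<close>

context elementary_2_group
begin

text \<open>
  Writing signs additively, as truth values under exclusive or, the defining condition on \<open>M\<close> says
  that the mixed second difference with the same shift \<open>d\<close> in both arguments is 1 for all \<open>d \<noteq> \<one>\<close>.
  The quotient of two solutions has second difference 0 instead. The parameter \<open>\<epsilon>\<close> covers both
  cases, since the consequences drawn from them have the same shape.
\<close>

definition second_difference :: "bool \<Rightarrow> ('a \<Rightarrow> 'a \<Rightarrow> bool) \<Rightarrow> bool" where
  "second_difference \<epsilon> m \<longleftrightarrow>
     (\<forall>x\<in>carrier G. \<forall>a\<in>carrier G. \<forall>d\<in>carrier G. (\<epsilon> \<longrightarrow> d \<noteq> \<one>) \<longrightarrow>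
        ((m x a \<noteq> m x (a \<otimes> d)) \<noteq> (m (x \<otimes> d) a \<noteq> m (x \<otimes> d) (a \<otimes> d))) = \<epsilon>)"

text \<open>
  A function of the row alone or of the column alone has zero second difference, so the values in
  the row and the column of \<open>\<one>\<close> can be removed.
\<close>

definition normalize :: "('a \<Rightarrow> 'a \<Rightarrow> bool) \<Rightarrow> 'a \<Rightarrow> 'a \<Rightarrow> bool" where
  "normalize m x a \<longleftrightarrow> (m x a \<noteq> m x \<one>) \<noteq> (m \<one> a \<noteq> m \<one> \<one>)"

lemma normalize_one: "normalize m x \<one> = False" "normalize m \<one> a = False"
  by (auto simp: normalize_def)

lemma second_difference_normalize:
  assumes "second_difference \<epsilon> m"
  shows "second_difference \<epsilon> (normalize m)"
  unfolding second_difference_def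
proof (intro ballI impI)
  fix x a d assume "x \<in> carrier G" "a \<in> carrier G" "d \<in> carrier G" "\<epsilon> \<longrightarrow> d \<noteq> \<one>"
  then have "((m x a \<noteq> m x (a \<otimes> d)) \<noteq> (m (x \<otimes> d) a \<noteq> m (x \<otimes> d) (a \<otimes> d))) = \<epsilon>"
    using assms unfolding second_difference_def by blast
  then show "((normalize m x a \<noteq> normalize m x (a \<otimes> d)) \<noteq>
      (normalize m (x \<otimes> d) a \<noteq> normalize m (x \<otimes> d) (a \<otimes> d))) = \<epsilon>"
    unfolding normalize_def by argo
qed

lemma second_differenceD:
  assumes "second_difference \<epsilon> m" "x \<in> carrier G" "y \<in> carrier G" "a \<in> carrier G" "\<epsilon> \<Longrightarrow> x \<noteq> y"
  shows "((m x a \<noteq> m x (x \<otimes> y \<otimes> a)) \<noteq> (m y a \<noteq> m y (x \<otimes> y \<otimes> a))) = \<epsilon>"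
proof -
  have "\<epsilon> \<longrightarrow> x \<otimes> y \<noteq> \<one>" using assms by (simp add: mult_eq_one_iff)
  moreover have "x \<otimes> (x \<otimes> y) = y" "a \<otimes> (x \<otimes> y) = x \<otimes> y \<otimes> a"
    using assms by (simp_all add: ac)
  ultimately show ?thesis
    using assms(1-4) unfolding second_difference_def by (metis m_closed)
qed

context
  fixes \<epsilon> m n
  assumes diff: "second_difference \<epsilon> m" and n: "n = normalize m"
begin

lemma normalized_diff:
  assumes "x \<in> carrier G" "y \<in> carrier G" "a \<in> carrier G" "\<epsilon> \<Longrightarrow> x \<noteq> y"
  shows "((n x a \<noteq> n x (x \<otimes> y \<otimes> a)) \<noteq> (n y a \<noteq> n y (x \<otimes> y \<otimes> a))) = \<epsilon>"
  unfolding n by (rule second_differenceD [OF second_difference_normalize [OF diff] assms])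

lemma normalized_row:
  assumes "x \<in> carrier G" "a \<in> carrier G" "\<epsilon> \<Longrightarrow> x \<noteq> \<one>"
  shows "n x (x \<otimes> a) \<longleftrightarrow> n x a \<noteq> \<epsilon>"
  using normalized_diff [of x \<one> a] assms by (auto simp: n normalize_one)

lemma normalized_diag:
  assumes "x \<in> carrier G" "\<epsilon> \<Longrightarrow> x \<noteq> \<one>"
  shows "n x x = \<epsilon>"
  using normalized_row [of x \<one>] assms by (auto simp: n normalize_one)

lemma normalized_commute:
  assumes "x \<in> carrier G" "y \<in> carrier G" "\<epsilon> \<Longrightarrow> x \<noteq> \<one> \<and> y \<noteq> \<one> \<and> x \<noteq> y"
  shows "n y x \<longleftrightarrow> n x y \<noteq> \<epsilon>"
proof -
  have "x \<otimes> y \<otimes> x = y" using assms by (simp add: ac)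
  then show ?thesis
    using normalized_diff [of x y x] normalized_diag [of x] normalized_diag [of y] assms by auto
qed

text \<open>
  The left-hand side is the coboundary of \<open>n\<close> (as a 2-cochain on the group) at \<open>(x, y, z)\<close>, that is,
  the associator of the algebra twisted by \<open>n\<close>. For independent \<open>x, y, z\<close> its four terms belong to
  the four lines of the Fano plane on \<open>x, y, z\<close> that avoid the point \<open>x \<otimes> z\<close>, and so do the terms
  of the second difference with shift \<open>x \<otimes> z\<close>; moving along a line or swapping two points on it
  costs one \<open>\<epsilon>\<close> each time.
\<close>

lemma normalized_associator:
  assumes c: "x \<in> carrier G" "y \<in> carrier G" "z \<in> carrier G"
    and "\<epsilon> \<Longrightarrow> x \<noteq> \<one> \<and> y \<noteq> \<one> \<and> z \<noteq> \<one> \<and> x \<noteq> y \<and> x \<noteq> z \<and> y \<noteq> z \<and> x \<otimes> y \<noteq> z"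
  shows "((n x y \<noteq> n (x \<otimes> y) z) \<noteq> (n y z \<noteq> n x (y \<otimes> z))) = \<epsilon>"
proof -
  have "((n x y \<noteq> n x (x \<otimes> z \<otimes> y)) \<noteq> (n z y \<noteq> n z (x \<otimes> z \<otimes> y))) = \<epsilon>"
    using normalized_diff [of x z y] assms by auto
  moreover have "n x (x \<otimes> z \<otimes> y) \<longleftrightarrow> n x (y \<otimes> z) \<noteq> \<epsilon>"
    using normalized_row [of x "y \<otimes> z"] assms by (auto simp: ac)
  moreover have "n z (x \<otimes> z \<otimes> y) \<longleftrightarrow> n z (x \<otimes> y) \<noteq> \<epsilon>"
    using normalized_row [of z "x \<otimes> y"] assms by (auto simp: ac)
  moreover have "n z y \<longleftrightarrow> n y z \<noteq> \<epsilon>"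
    using normalized_commute [of y z] assms by auto
  moreover have "n z (x \<otimes> y) \<longleftrightarrow> n (x \<otimes> y) z \<noteq> \<epsilon>"
    using normalized_commute [of "x \<otimes> y" z] assms by (auto simp: mult_eq_one_iff)
  ultimately show ?thesis by argo
qed

end

text \<open>
  The five associators of four elements add up to zero, because a coboundary is a cocycle. If the
  elements are independent, all five are 1, and five is odd.
\<close>

lemma no_fourth_generator:
  assumes diff: "second_difference True m"
    and H: "subgroup H G" and w: "w \<in> carrier G" "w \<notin> H"
  shows "card H \<le> 4"
proof (rule ccontr)
  interpret H: subgroup H G by fact
  assume "\<not> card H \<le> 4"
  have big: "\<exists>t\<in>H. t \<notin> {a, b, c, d}" for a b c d
  proof -
    have "card {a, b, c, d} \<le> 4" by (simp add: card_insert_if)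
    then show ?thesis using \<open>\<not> card H \<le> 4\<close>
      by (metis card_mono finite.emptyI finite_insert le_trans subsetI)
  qed
  \<comment> \<open>Together with an element outside \<open>H\<close>, these three are independent.\<close>
  obtain x where x: "x \<in> H" "x \<noteq> \<one>" using big [of \<one> \<one> \<one> \<one>] by auto
  obtain y where y: "y \<in> H" "y \<notin> {\<one>, x}" using big [of \<one> x x x] by auto
  obtain z where z: "z \<in> H" "z \<notin> {\<one>, x, y, x \<otimes> y}" using big [of \<one> x y "x \<otimes> y"] by auto
  have c: "x \<in> carrier G" "y \<in> carrier G" "z \<in> carrier G" using x y z by auto
  define n where "n = normalize m"
  have indep: "((n p q \<noteq> n (p \<otimes> q) r) \<noteq> (n q r \<noteq> n p (q \<otimes> r)))"
    if "p \<in> carrier G" "q \<in> carrier G" "r \<in> carrier G"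
      "p \<noteq> \<one>" "q \<noteq> \<one>" "r \<noteq> \<one>" "p \<noteq> q" "p \<noteq> r" "q \<noteq> r" "p \<otimes> q \<noteq> r" for p q r
    using normalized_associator [OF diff n_def, of p q r] that by simp
  have out: "w \<noteq> h" "z \<otimes> w \<noteq> h" if "h \<in> H" for h
    using coset_disjoint [OF H w, of z] w z c that by (auto simp: m_comm)
  have zH: "z \<noteq> x \<otimes> y" "x \<otimes> y \<in> H" "y \<otimes> z \<in> H" "\<one> \<in> H" "x \<otimes> (y \<otimes> z) \<in> H" using x y z by auto
  have nt: "x \<otimes> y \<noteq> \<one>" "y \<otimes> z \<noteq> \<one>" "x \<noteq> y \<otimes> z"
    using x y z c shift_iff [of y x z] by (auto simp: mult_eq_one_iff m_comm)
  note facts = x y z w c zH nt out out [symmetric]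
  have i0: "((n x y \<noteq> n (x \<otimes> y) z) \<noteq> (n y z \<noteq> n x (y \<otimes> z)))"
    by (rule indep) (use facts in \<open>auto simp: m_assoc\<close>)
  have i1: "((n y z \<noteq> n (y \<otimes> z) w) \<noteq> (n z w \<noteq> n y (z \<otimes> w)))"
    by (rule indep) (use facts in \<open>auto simp: m_assoc\<close>)
  have i2: "((n (x \<otimes> y) z \<noteq> n ((x \<otimes> y) \<otimes> z) w) \<noteq> (n z w \<noteq> n (x \<otimes> y) (z \<otimes> w)))"
    by (rule indep) (use facts in \<open>auto simp: m_assoc\<close>)
  have i3: "((n x (y \<otimes> z) \<noteq> n (x \<otimes> (y \<otimes> z)) w) \<noteq> (n (y \<otimes> z) w \<noteq> n x ((y \<otimes> z) \<otimes> w)))"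
    by (rule indep) (use facts in \<open>auto simp: m_assoc\<close>)
  have i4: "((n x y \<noteq> n (x \<otimes> y) (z \<otimes> w)) \<noteq> (n y (z \<otimes> w) \<noteq> n x (y \<otimes> (z \<otimes> w))))"
    by (rule indep) (use facts in \<open>auto simp: m_assoc\<close>)
  show False
    using i0 i1 i2 i3 i4 c w by (simp add: m_assoc) argo
qed

lemma order_cases:
  assumes "second_difference True m" "carrier G \<noteq> {\<one>}"
  shows "order G \<in> {2, 4, 8}"
proof -
  have "card (carrier G) \<in> {1, 2, 4, 8}"
  proof (induction rule: subgroup_induct)
    case (adjoin H e)
    then show ?case
      using no_fourth_generator [OF assms(1), of H e] card_adjoin [of H e] by auto
  qed simp
  moreover have "card (carrier G) \<noteq> 1"
    using assms(2) by (metis card_1_singletonE one_closed singletonD)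
  ultimately show ?thesis by (simp add: order_def)
qed

text \<open>
  After normalization a function with vanishing second differences is a symmetric 2-cocycle with
  zero diagonal. It describes an abelian extension of exponent 2, which splits, so it is a
  coboundary. The splitting is constructed one generator \<open>e\<close> at a time by
  \<open>w (e \<otimes> h) = w h + n h e\<close>.
\<close>

lemma second_difference_coboundary:
  assumes diff: "second_difference False m"
  obtains u v w :: "'a \<Rightarrow> bool" where
    "\<forall>x\<in>carrier G. \<forall>a\<in>carrier G. m x a \<longleftrightarrow> (u x \<noteq> v a) \<noteq> w (x \<otimes> a)"
proof -
  define n where "n = normalize m"
  have comm: "n y x = n x y" if "x \<in> carrier G" "y \<in> carrier G" for x y
    using normalized_commute [OF diff n_def] that by auto
  have row: "n x (x \<otimes> a) = n x a" if "x \<in> carrier G" "a \<in> carrier G" for x a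
    using normalized_row [OF diff n_def] that by auto
  have assoc: "((n x y \<noteq> n (x \<otimes> y) z) = (n y z \<noteq> n x (y \<otimes> z)))"
    if "x \<in> carrier G" "y \<in> carrier G" "z \<in> carrier G" for x y z
    using normalized_associator [OF diff n_def] that by auto
  have "\<exists>w. \<forall>x\<in>carrier G. \<forall>y\<in>carrier G. n x y \<longleftrightarrow> (w x \<noteq> w y) \<noteq> w (x \<otimes> y)"
  proof (induction rule: subgroup_induct)
    case trivial
    show ?case by (rule exI [of _ "\<lambda>_. False"]) (simp add: n_def normalize_one)
  next
    case (adjoin H e)
    from adjoin(4) obtain w where w: "\<forall>x\<in>H. \<forall>y\<in>H. n x y \<longleftrightarrow> (w x \<noteq> w y) \<noteq> w (x \<otimes> y)"
      by (elim exE)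
    interpret H: subgroup H G by fact
    have hc: "h \<in> carrier G" if "h \<in> H" for h using that by simp
    define w' where "w' x = (if x \<in> H then w x else w (e \<otimes> x) \<noteq> n (e \<otimes> x) e)" for x
    have w0: "w' h = w h" if "h \<in> H" for h using that by (simp add: w'_def)
    have w1: "w' (e \<otimes> h) = (w h \<noteq> n h e)" if "h \<in> H" for h
      using coset_disjoint [OF adjoin(1-3) that] hc [OF that] adjoin by (simp add: w'_def square_left)
    have "n x y \<longleftrightarrow> (w' x \<noteq> w' y) \<noteq> w' (x \<otimes> y)"
      if xy: "x \<in> adjoin e H" "y \<in> adjoin e H" for x y
    proof -
      obtain h k where hk: "h \<in> H" "k \<in> H" "x = h \<or> x = e \<otimes> h" "y = k \<or> y = e \<otimes> k"
        using xy by (auto simp: adjoin_def)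
      have hkH: "h \<otimes> k \<in> H" using hk by blast
      note cs = hc [OF hk(1)] hc [OF hk(2)] adjoin(2)
      have e1: "h \<otimes> (e \<otimes> k) = e \<otimes> (h \<otimes> k)" "(e \<otimes> h) \<otimes> k = e \<otimes> (h \<otimes> k)"
        "(e \<otimes> h) \<otimes> (e \<otimes> k) = h \<otimes> k"
        using cs by (simp_all add: ac)
      have whk: "n h k \<longleftrightarrow> (w h \<noteq> w k) \<noteq> w (h \<otimes> k)" using w hk by blast
      have a1: "n h (e \<otimes> k) \<longleftrightarrow> (n h k \<noteq> n (h \<otimes> k) e) \<noteq> n k e"
        using assoc [of h k e] cs by (simp add: m_comm) argo
      have a2: "n (e \<otimes> h) k \<longleftrightarrow> (n h k \<noteq> n (h \<otimes> k) e) \<noteq> n h e"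
        using assoc [of k h e] comm [of "e \<otimes> h" k] comm [of h k] cs by (simp add: m_comm) argo
      have a3: "n (e \<otimes> h) (e \<otimes> k) \<longleftrightarrow> (n h e \<noteq> n h k) \<noteq> n k e"
        using assoc [of "e \<otimes> h" e k] row [of e h] comm [of "e \<otimes> h" e] comm [of h e] comm [of k e] cs
        by (simp add: ac) argo
      show ?thesis
        using hk(3,4) whk a1 a2 a3
        by (elim disjE) (simp_all add: e1 w0 w1 hk hkH, argo+)
    qed
    then show ?case by (intro exI [of _ w'] ballI)
  qed
  then obtain w where w: "\<forall>x\<in>carrier G. \<forall>y\<in>carrier G. n x y \<longleftrightarrow> (w x \<noteq> w y) \<noteq> w (x \<otimes> y)"
    by (elim exE)
  show thesis
  proof (rule that [of "\<lambda>x. w x \<noteq> m x \<one>" "\<lambda>a. (w a \<noteq> m \<one> a) \<noteq> m \<one> \<one>" w])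
    show "\<forall>x\<in>carrier G. \<forall>a\<in>carrier G.
      m x a \<longleftrightarrow> ((w x \<noteq> m x \<one>) \<noteq> ((w a \<noteq> m \<one> a) \<noteq> m \<one> \<one>)) \<noteq> w (x \<otimes> a)"
    proof (intro ballI)
      fix x a assume "x \<in> carrier G" "a \<in> carrier G"
      then have "n x a \<longleftrightarrow> (w x \<noteq> w a) \<noteq> w (x \<otimes> a)" using w by blast
      then show "m x a \<longleftrightarrow> ((w x \<noteq> m x \<one>) \<noteq> ((w a \<noteq> m \<one> a) \<noteq> m \<one> \<one>)) \<noteq> w (x \<otimes> a)"
        unfolding n_def normalize_def by argo
    qed
  qed
qed

end

section \<open>Partitions into zero-one matrices\<close>

lemma zero_one_cases:
  assumes "A \<in> zero_one_matrices X"
  shows "A x y = 0 \<or> x \<in> X \<and> y \<in> X \<and> A x y = 1"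
  using assms by (auto simp: zero_one_matrices_def matrices_def)

lemma matrices_eqI:
  assumes "A \<in> matrices X" "B \<in> matrices X" "\<And>x y. x \<in> X \<Longrightarrow> y \<in> X \<Longrightarrow> A x y = B x y"
  shows "A = B"
  using assms unfolding matrices_def by (intro ext) (metis (mono_tags, lifting) mem_Collect_eq)

lemma zero_one_in_matrices: "A \<in> zero_one_matrices X \<Longrightarrow> A \<in> matrices X"
  by (simp add: zero_one_matrices_def)

lemma matrix_mult_in_matrices:
  assumes "A \<in> matrices X" "B \<in> matrices X"
  shows "matrix_mult X A B \<in> matrices X"
  using assms unfolding matrices_def matrix_mult_def
  by (simp, metis (no_types, lifting) mult_eq_0_iff sum.neutral)

lemma add_in_matrices:
  assumes "A \<in> matrices X" "B \<in> matrices X"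
  shows "(\<lambda>x y. A x y + B x y) \<in> matrices X"
proof -
  have "x \<in> X \<and> y \<in> X" if "A x y + B x y \<noteq> 0" for x y
  proof -
    have "A x y \<noteq> 0 \<or> B x y \<noteq> 0" using that by auto
    then show ?thesis using assms unfolding matrices_def by blast
  qed
  then show ?thesis unfolding matrices_def by simp
qed

lemma matrix_mult_add_left:
  "matrix_mult X (\<lambda>x y. A x y + A' x y) B x y = matrix_mult X A B x y + matrix_mult X A' B x y"
  by (simp add: matrix_mult_def sum.distrib ring_distribs)

definition partition_matrices :: "'x set \<Rightarrow> 'x cmatrix set \<Rightarrow> bool" where
  "partition_matrices X S \<longleftrightarrow> finite S \<and> S \<subseteq> zero_one_matrices X \<and>
     (\<forall>x\<in>X. \<forall>y\<in>X. \<exists>!A. A \<in> S \<and> A x y = 1)"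

lemma partition_entry:
  assumes "partition_matrices X S" "A \<in> S" "A x y = 1" "C \<in> S"
  shows "C x y = (if C = A then 1 else 0)"
proof -
  have zo: "A \<in> zero_one_matrices X" "C \<in> zero_one_matrices X"
    using assms by (auto simp: partition_matrices_def)
  then have "x \<in> X" "y \<in> X" using zero_one_cases [of A X x y] assms(3) by auto
  then have "\<exists>!A. A \<in> S \<and> A x y = 1" using assms(1) by (simp add: partition_matrices_def)
  then have "C \<noteq> A \<Longrightarrow> C x y \<noteq> 1" using assms by blast
  then have "C \<noteq> A \<Longrightarrow> C x y = 0" using zero_one_cases [OF zo(2), of x y] by blast
  then show ?thesis using assms(3) by (cases "C = A") simp_all
qed

lemma partition_sum:
  assumes "partition_matrices X S" "A \<in> S" "A x y = 1"
  shows "(\<Sum>C\<in>S. q C * C x y) = q A"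
proof -
  have "(\<Sum>C\<in>S. q C * C x y) = (\<Sum>C\<in>S. if C = A then q C else 0)"
    by (rule sum.cong) (auto simp: partition_entry [OF assms])
  also have "\<dots> = q A"
    using assms by (simp add: partition_matrices_def)
  finally show ?thesis .
qed

lemma partition_matrices_iff:
  assumes "finite S" "S \<subseteq> zero_one_matrices X"
  shows "(\<lambda>x y. \<Sum>A\<in>S. A x y) = all_one_matrix X \<longleftrightarrow> partition_matrices X S"
proof
  assume eq: "(\<lambda>x y. \<Sum>A\<in>S. A x y) = all_one_matrix X"
  have "\<exists>!A. A \<in> S \<and> A x y = 1" if "x \<in> X" "y \<in> X" for x y
  proof -
    have "1 = (\<Sum>A\<in>S. A x y)"
      using fun_cong [OF fun_cong [OF eq, of x], of y] that by (simp add: all_one_matrix_def)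
    also have "(\<Sum>A\<in>S. A x y) = (\<Sum>A\<in>S. if A x y = 1 then 1 else 0)"
    proof (rule sum.cong)
      fix A assume "A \<in> S"
      then show "A x y = (if A x y = 1 then 1 else 0)"
        using zero_one_cases [of A X x y] assms(2) by auto
    qed simp
    also have "\<dots> = of_nat (card {A \<in> S. A x y = 1})"
      using assms(1) by (simp add: sum.If_cases Int_def)
    finally have "card {A \<in> S. A x y = 1} = 1"
      using of_nat_eq_1_iff [where 'a = complex] by simp
    then obtain B where "{A \<in> S. A x y = 1} = {B}" by (rule card_1_singletonE)
    then show ?thesis by (intro ex1I [of _ B]) auto
  qed
  then show "partition_matrices X S"
    using assms by (simp add: partition_matrices_def)
next
  assume p: "partition_matrices X S"
  show "(\<lambda>x y. \<Sum>A\<in>S. A x y) = all_one_matrix X"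
  proof (intro ext)
    fix x y
    show "(\<Sum>A\<in>S. A x y) = all_one_matrix X x y"
    proof (cases "x \<in> X \<and> y \<in> X")
      case True
      then obtain A where "A \<in> S" "A x y = 1" using p unfolding partition_matrices_def by blast
      from partition_sum [OF p this, of "\<lambda>_. 1"] show ?thesis
        using True by (simp add: all_one_matrix_def)
    next
      case False
      then have "A x y = 0" if "A \<in> S" for A
        using that zero_one_cases [of A X x y] assms(2) by auto
      then have "(\<Sum>A\<in>S. A x y) = 0" by (intro sum.neutral) blast
      then show ?thesis using False by (auto simp: all_one_matrix_def)
    qed
  qed
qed

text \<open>
  The Jordan product is half of the anticommutator, so half-integral structure constants amount to
  anticommutators in the integer span.
\<close>

definition integer_span :: "'x cmatrix set \<Rightarrow> 'x cmatrix \<Rightarrow> bool" where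
  "integer_span S F \<longleftrightarrow> (\<exists>q :: 'x cmatrix \<Rightarrow> int. F = (\<lambda>x y. \<Sum>C\<in>S. of_int (q C) * C x y))"

lemma integer_span_member:
  assumes "finite S" "A \<in> S"
  shows "integer_span S A"
  unfolding integer_span_def
proof (intro exI ext)
  fix x y
  have "(\<Sum>C\<in>S. of_int (if C = A then 1 else 0) * C x y) = (\<Sum>C\<in>S. if C = A then C x y else 0)"
    by (rule sum.cong) auto
  then show "A x y = (\<Sum>C\<in>S. of_int (if C = A then 1 else 0) * C x y)"
    using assms by simp
qed

lemma integer_span_add:
  assumes "integer_span S A" "integer_span S B"
  shows "integer_span S (\<lambda>x y. A x y + B x y)"
proof -
  obtain p q where "A = (\<lambda>x y. \<Sum>C\<in>S. of_int (p C) * C x y)" "B = (\<lambda>x y. \<Sum>C\<in>S. of_int (q C) * C x y)"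
    using assms unfolding integer_span_def by blast
  then show ?thesis
    unfolding integer_span_def
    by (intro exI [of _ "\<lambda>C. p C + q C"]) (simp add: sum.distrib ring_distribs)
qed

lemma jordan_schemeI:
  assumes "finite X" "partition_matrices X S" "identity_matrix X \<in> S"
    and sym: "\<And>A. A \<in> S \<Longrightarrow> transpose_matrix A = A"
    and span: "\<And>A B. A \<in> S \<Longrightarrow> B \<in> S \<Longrightarrow>
      integer_span S (\<lambda>x y. matrix_mult X A B x y + matrix_mult X B A x y)"
  shows "jordan_scheme X S"
proof -
  have S: "finite S" "S \<subseteq> zero_one_matrices X"
    using assms(2) by (auto simp: partition_matrices_def)
  define q where "q A B = (SOME q :: _ \<Rightarrow> int. (\<lambda>x y. matrix_mult X A B x y + matrix_mult X B A x y) =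
      (\<lambda>x y. \<Sum>C\<in>S. of_int (q C) * C x y))" for A B
  have q: "(\<lambda>x y. matrix_mult X A B x y + matrix_mult X B A x y) = (\<lambda>x y. \<Sum>C\<in>S. of_int (q A B C) * C x y)"
    if "A \<in> S" "B \<in> S" for A B
    using span [OF that] unfolding q_def integer_span_def by (rule someI_ex)
  define p where "p A B C = (of_int (q A B C) / 2 :: complex)" for A B C
  have "jordan_mult X A B = (\<lambda>x y. \<Sum>C\<in>S. p A B C * C x y)" if "A \<in> S" "B \<in> S" for A B
  proof (intro ext)
    fix x y
    have "jordan_mult X A B x y = 1/2 * (\<Sum>C\<in>S. of_int (q A B C) * C x y)"
      unfolding jordan_mult_def using fun_cong [OF fun_cong [OF q [OF that], of x], of y] by simp
    then show "jordan_mult X A B x y = (\<Sum>C\<in>S. p A B C * C x y)"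
      by (simp add: p_def sum_divide_distrib)
  qed
  moreover have "p A B C \<in> half_integers" for A B C
    by (auto simp: p_def half_integers_def)
  ultimately show ?thesis
    unfolding jordan_scheme_def
    using assms(1,3) sym S partition_matrices_iff [OF S] assms(2)
    by (intro conjI ballI exI [of _ p]) simp_all
qed

lemma association_scheme_partition: "association_scheme X S \<Longrightarrow> partition_matrices X S"
  using partition_matrices_iff [of S X] by (simp add: association_scheme_def)

section \<open>Permutation matrices\<close>

definition perm_matrix :: "'x set \<Rightarrow> ('x \<Rightarrow> 'x) \<Rightarrow> 'x cmatrix" where
  "perm_matrix X \<pi> = (\<lambda>x y. if x \<in> X \<and> y \<in> X \<and> y = \<pi> x then 1 else 0)"

lemma perm_matrix_zero_one: "perm_matrix X \<pi> \<in> zero_one_matrices X"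
  by (auto simp: perm_matrix_def zero_one_matrices_def matrices_def)

lemma perm_in_matrices: "perm_matrix X \<pi> \<in> matrices X"
  by (intro zero_one_in_matrices perm_matrix_zero_one)

lemma perm_matrix_cong:
  assumes "\<And>x. x \<in> X \<Longrightarrow> \<pi> x = \<rho> x"
  shows "perm_matrix X \<pi> = perm_matrix X \<rho>"
  using assms by (auto simp: perm_matrix_def fun_eq_iff)

lemma perm_matrix_eqD:
  assumes "perm_matrix X \<pi> = perm_matrix X \<rho>" "x \<in> X" "\<pi> x \<in> X"
  shows "\<pi> x = \<rho> x"
  using fun_cong [OF fun_cong [OF assms(1), of x], of "\<pi> x"] assms(2,3)
  by (auto simp: perm_matrix_def split: if_splits)

lemma transpose_perm_matrix:
  assumes "\<And>x. x \<in> X \<Longrightarrow> \<pi> x \<in> X" "\<And>x. x \<in> X \<Longrightarrow> \<rho> x \<in> X"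
    "\<And>x. x \<in> X \<Longrightarrow> \<rho> (\<pi> x) = x" "\<And>x. x \<in> X \<Longrightarrow> \<pi> (\<rho> x) = x"
  shows "transpose_matrix (perm_matrix X \<pi>) = perm_matrix X \<rho>"
  using assms by (auto simp: perm_matrix_def transpose_matrix_def fun_eq_iff)

lemma mult_perm_matrix_left:
  assumes "finite X" "x \<in> X" "\<pi> x \<in> X"
  shows "matrix_mult X (perm_matrix X \<pi>) B x y = B (\<pi> x) y"
proof -
  have "matrix_mult X (perm_matrix X \<pi>) B x y = (\<Sum>z\<in>X. if z = \<pi> x then B z y else 0)"
    unfolding matrix_mult_def by (rule sum.cong) (use assms in \<open>auto simp: perm_matrix_def\<close>)
  then show ?thesis using assms by simp
qed

lemma mult_perm_matrix_right:
  assumes "finite X" "y \<in> X" "\<rho> y \<in> X"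
    "\<And>x. x \<in> X \<Longrightarrow> \<rho> (\<pi> x) = x" "\<And>x. x \<in> X \<Longrightarrow> \<pi> (\<rho> x) = x"
  shows "matrix_mult X B (perm_matrix X \<pi>) x y = B x (\<rho> y)"
proof -
  have "matrix_mult X B (perm_matrix X \<pi>) x y = (\<Sum>z\<in>X. if z = \<rho> y then B x z else 0)"
    unfolding matrix_mult_def
  proof (rule sum.cong)
    fix z assume "z \<in> X"
    then have "y = \<pi> z \<longleftrightarrow> z = \<rho> y" using assms by metis
    then show "B x z * perm_matrix X \<pi> z y = (if z = \<rho> y then B x z else 0)"
      using assms \<open>z \<in> X\<close> by (auto simp: perm_matrix_def)
  qed simp
  then show ?thesis using assms by simp
qed

lemma mult_perm_matrices:
  assumes "finite X" "\<And>x. x \<in> X \<Longrightarrow> \<pi> x \<in> X"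
  shows "matrix_mult X (perm_matrix X \<pi>) (perm_matrix X \<rho>) = perm_matrix X (\<lambda>x. \<rho> (\<pi> x))"
proof (rule matrices_eqI [of _ X])
  show "matrix_mult X (perm_matrix X \<pi>) (perm_matrix X \<rho>) \<in> matrices X"
    by (intro matrix_mult_in_matrices zero_one_in_matrices perm_matrix_zero_one)
  show "perm_matrix X (\<lambda>x. \<rho> (\<pi> x)) \<in> matrices X"
    by (intro zero_one_in_matrices perm_matrix_zero_one)
  fix x y assume "x \<in> X" "y \<in> X"
  then show "matrix_mult X (perm_matrix X \<pi>) (perm_matrix X \<rho>) x y = perm_matrix X (\<lambda>x. \<rho> (\<pi> x)) x y"
    using assms(2) [of x] by (simp add: mult_perm_matrix_left [OF assms(1)]) (simp add: perm_matrix_def)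
qed

lemma mult_perm_matrices_entry:
  assumes "finite X" "x \<in> X" "y \<in> X" "\<pi> x \<in> X"
  shows "matrix_mult X (perm_matrix X \<pi>) (perm_matrix X \<rho>) x y = (if y = \<rho> (\<pi> x) then 1 else 0)"
  using mult_perm_matrix_left [of X x \<pi> "perm_matrix X \<rho>" y] assms by (simp add: perm_matrix_def [of X \<rho>])

lemma symmetrize_perm_involution:
  assumes "\<And>x. x \<in> X \<Longrightarrow> \<pi> x \<in> X" "\<And>x. x \<in> X \<Longrightarrow> \<pi> (\<pi> x) = x"
  shows "symmetrize (perm_matrix X \<pi>) = perm_matrix X \<pi>"
  using transpose_perm_matrix [of X \<pi> \<pi>] assms by (simp add: symmetrize_def)

section \<open>Association schemes and their thin elements\<close>

lemma association_scheme_product: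
  assumes T: "association_scheme X T" and AB: "A \<in> T" "B \<in> T"
  obtains q where "matrix_mult X A B = (\<lambda>x y. \<Sum>E\<in>T. q E * E x y)"
proof -
  obtain p where "\<forall>A\<in>T. \<forall>B\<in>T. matrix_mult X A B = (\<lambda>x y. \<Sum>E\<in>T. p A B E * E x y)"
    using T unfolding association_scheme_def by (elim conjE exE)
  then have "matrix_mult X A B = (\<lambda>x y. \<Sum>E\<in>T. p A B E * E x y)" using AB by blast
  then show thesis by (rule that)
qed

text \<open>
  All row sums of \<open>C\<close> agree: the diagonal of \<open>C\<close> times its transpose lists them, and that diagonal
  is constant because the identity matrix is the only class that meets it.
\<close>

lemma association_scheme_regular:
  assumes T: "association_scheme X T" and C: "C \<in> T" "C x y = 1" and "x' \<in> X"
  shows "\<exists>y'. C x' y' = 1"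
proof (rule ccontr)
  assume "\<nexists>y'. C x' y' = 1"
  then have zero: "C x' y' = 0" for y'
    using zero_one_cases [of C X x' y'] T C by (auto simp: association_scheme_def)
  have p: "partition_matrices X T" by (rule association_scheme_partition [OF T])
  have xX: "x \<in> X" "y \<in> X"
    using zero_one_cases [of C X x y] T C by (auto simp: association_scheme_def)
  have fin: "finite X" using T by (simp add: association_scheme_def)
  have C': "transpose_matrix C \<in> T" using T C by (simp add: association_scheme_def)
  obtain q where q: "matrix_mult X C (transpose_matrix C) = (\<lambda>x y. \<Sum>E\<in>T. q E * E x y)"
    using association_scheme_product [OF T C(1) C'] .
  have I: "identity_matrix X \<in> T" using T by (simp add: association_scheme_def)
  have diag: "(\<Sum>w\<in>X. C z w * C z w) = q (identity_matrix X)" if "z \<in> X" for z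
  proof -
    have "(\<Sum>w\<in>X. C z w * C z w) = (\<Sum>E\<in>T. q E * E z z)"
      using fun_cong [OF fun_cong [OF q, of z], of z] by (simp add: matrix_mult_def transpose_matrix_def)
    also have "\<dots> = q (identity_matrix X)"
      by (rule partition_sum [OF p I]) (simp add: identity_matrix_def that)
    finally show ?thesis .
  qed
  have "q (identity_matrix X) = 0" using diag [OF \<open>x' \<in> X\<close>] zero by simp
  then have "0 = (\<Sum>w\<in>X. C x w * C x w)" using diag [OF xX(1)] by simp
  also have "(\<Sum>w\<in>X. C x w * C x w) = (\<Sum>w\<in>X. if C x w = 1 then 1 else 0)"
  proof (rule sum.cong)
    fix w assume "w \<in> X"
    show "C x w * C x w = (if C x w = 1 then 1 else 0)"
      using zero_one_cases [of C X x w] T C by (auto simp: association_scheme_def)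
  qed simp
  also have "\<dots> = of_nat (card {w \<in> X. C x w = 1})"
    using fin by (simp add: sum.If_cases Int_def)
  finally have "card {w \<in> X. C x w = 1} = 0" by simp
  then show False using fin xX C by auto
qed

text \<open>
  The product is a 0/1 combination of classes. A class occurring in it has at most one entry in
  every row and, by regularity, at least one, so it is the whole product.
\<close>

lemma thin_mult:
  assumes T: "association_scheme X T" and "X \<noteq> {}"
    and \<pi>: "perm_matrix X \<pi> \<in> T" "\<And>x. x \<in> X \<Longrightarrow> \<pi> x \<in> X"
    and \<rho>: "perm_matrix X \<rho> \<in> T" "\<And>x. x \<in> X \<Longrightarrow> \<rho> x \<in> X"
  shows "perm_matrix X (\<lambda>x. \<rho> (\<pi> x)) \<in> T"
proof -
  have p: "partition_matrices X T" by (rule association_scheme_partition [OF T])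
  have fin: "finite X" using T by (simp add: association_scheme_def)
  obtain q where "matrix_mult X (perm_matrix X \<pi>) (perm_matrix X \<rho>) = (\<lambda>x y. \<Sum>E\<in>T. q E * E x y)"
    using association_scheme_product [OF T \<pi>(1) \<rho>(1)] .
  then have q: "perm_matrix X (\<lambda>x. \<rho> (\<pi> x)) x y = (\<Sum>E\<in>T. q E * E x y)" for x y
    using mult_perm_matrices [of X \<pi> \<rho>, OF fin \<pi>(2)] by simp
  have val: "q C = perm_matrix X (\<lambda>x. \<rho> (\<pi> x)) x y" if "C \<in> T" "C x y = 1" for C x y
    using partition_sum [OF p that, of q] q by simp
  obtain x where x: "x \<in> X" using \<open>X \<noteq> {}\<close> by blast
  then obtain C where C: "C \<in> T" "C x (\<rho> (\<pi> x)) = 1"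
    using p \<pi> \<rho> unfolding partition_matrices_def by blast
  then have "q C = 1" using val [OF C] x \<pi> \<rho> by (simp add: perm_matrix_def)
  then have only: "x' \<in> X \<and> y' = \<rho> (\<pi> x')" if "C x' y' = 1" for x' y'
    using val [OF C(1) that] by (auto simp: perm_matrix_def split: if_splits)
  have "C = perm_matrix X (\<lambda>x. \<rho> (\<pi> x))"
  proof (intro ext)
    fix x' y'
    have zo: "C x' y' = 0 \<or> C x' y' = 1"
      using zero_one_cases [of C X x' y'] T C by (auto simp: association_scheme_def)
    show "C x' y' = perm_matrix X (\<lambda>x. \<rho> (\<pi> x)) x' y'"
    proof (cases "x' \<in> X \<and> y' = \<rho> (\<pi> x')")
      case True
      then obtain w where "C x' w = 1" using association_scheme_regular [OF T C] by blast
      then show ?thesis using only True \<pi> \<rho> by (auto simp: perm_matrix_def)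
    next
      case False
      then show ?thesis using only zo by (auto simp: perm_matrix_def)
    qed
  qed
  then show ?thesis using C by simp
qed

text \<open>
  If a permutation matrix were the sum of a non-symmetric class and its transpose, each row would
  meet only one of the two, and that class would have both empty and nonempty rows.
\<close>

lemma thin_of_symmetrization:
  assumes T: "association_scheme X T" and P: "perm_matrix X \<pi> \<in> symmetrize ` T"
    and \<pi>: "\<And>x. x \<in> X \<Longrightarrow> \<pi> x \<in> X" "\<And>x. x \<in> X \<Longrightarrow> \<pi> (\<pi> x) = x"
  shows "perm_matrix X \<pi> \<in> T"
proof -
  obtain C where C: "C \<in> T" "perm_matrix X \<pi> = symmetrize C" using P by blast
  have zo: "C x y = 0 \<or> x \<in> X \<and> y \<in> X \<and> C x y = 1" for x y
    using zero_one_cases [of C X x y] T C by (auto simp: association_scheme_def)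
  have "transpose_matrix C = C"
  proof (rule ccontr)
    assume ns: "transpose_matrix C \<noteq> C"
    then have eq: "perm_matrix X \<pi> x y = C x y + C y x" for x y
      using C(2) by (simp add: symmetrize_def matrix_add_def transpose_matrix_def)
    have supp: "y = \<pi> x \<and> C y x = 0" if "C x y = 1" for x y
      using eq [of x y] zo [of y x] that by (auto simp: perm_matrix_def split: if_splits)
    obtain x y where xy: "C x y = 1"
      using ns zo by (metis (no_types, opaque_lifting) ext transpose_matrix_def)
    then have X: "x \<in> X" "y \<in> X" using zo [of x y] by auto
    obtain w where w: "C y w = 1" using association_scheme_regular [OF T C(1) xy X(2)] by blast
    have "w = \<pi> y" "y = \<pi> x" using supp w xy by blast+
    then have "w = x" using \<pi>(2) X by simp
    then show False using supp [OF xy] w by (metis zero_neq_one)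
  qed
  then show ?thesis using C by (simp add: symmetrize_def)
qed

text \<open>
  The regular case of the scheme of a permutation group: sharp transitivity makes the permutation
  matrices partition the pairs of points. The conditions concern the maps on \<open>X\<close> only, since their
  values elsewhere do not enter the matrices.
\<close>

lemma thin_association_scheme:
  assumes fin: "finite X" "finite \<Gamma>" and "X \<noteq> {}"
    and maps: "\<And>\<pi> x. \<pi> \<in> \<Gamma> \<Longrightarrow> x \<in> X \<Longrightarrow> \<pi> x \<in> X"
    and unit: "\<exists>\<pi>\<in>\<Gamma>. \<forall>x\<in>X. \<pi> x = x"
    and closed: "\<And>\<pi> \<rho>. \<pi> \<in> \<Gamma> \<Longrightarrow> \<rho> \<in> \<Gamma> \<Longrightarrow> \<exists>\<tau>\<in>\<Gamma>. \<forall>x\<in>X. \<tau> x = \<rho> (\<pi> x)"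
    and inverse: "\<And>\<pi>. \<pi> \<in> \<Gamma> \<Longrightarrow> \<exists>\<rho>\<in>\<Gamma>. \<forall>x\<in>X. \<rho> (\<pi> x) = x \<and> \<pi> (\<rho> x) = x"
    and transitive: "\<And>x y. x \<in> X \<Longrightarrow> y \<in> X \<Longrightarrow> \<exists>\<pi>\<in>\<Gamma>. \<pi> x = y"
    and semiregular: "\<And>\<pi> \<rho> x. \<pi> \<in> \<Gamma> \<Longrightarrow> \<rho> \<in> \<Gamma> \<Longrightarrow> x \<in> X \<Longrightarrow> \<pi> x = \<rho> x \<Longrightarrow> \<forall>y\<in>X. \<pi> y = \<rho> y"
  shows "association_scheme X (perm_matrix X ` \<Gamma>)"
proof -
  let ?T = "perm_matrix X ` \<Gamma>"
  have T: "finite ?T" "?T \<subseteq> zero_one_matrices X"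
    using fin perm_matrix_zero_one by auto
  have "\<exists>!A. A \<in> ?T \<and> A x y = 1" if xy: "x \<in> X" "y \<in> X" for x y
  proof -
    obtain \<pi> where \<pi>: "\<pi> \<in> \<Gamma>" "\<pi> x = y" using transitive xy by blast
    show ?thesis
    proof (rule ex1I [of _ "perm_matrix X \<pi>"])
      show "perm_matrix X \<pi> \<in> ?T \<and> perm_matrix X \<pi> x y = 1"
        using \<pi> xy by (auto simp: perm_matrix_def)
      fix A assume "A \<in> ?T \<and> A x y = 1"
      then obtain \<rho> where \<rho>: "\<rho> \<in> \<Gamma>" "A = perm_matrix X \<rho>" "\<rho> x = y"
        by (auto simp: perm_matrix_def split: if_splits)
      then show "A = perm_matrix X \<pi>"
        using semiregular [of \<rho> \<pi> x] \<pi> xy by (auto intro: perm_matrix_cong)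
    qed
  qed
  then have part: "partition_matrices X ?T"
    using T by (simp add: partition_matrices_def)
  have "identity_matrix X \<in> ?T"
  proof -
    obtain \<pi> where "\<pi> \<in> \<Gamma>" "\<forall>x\<in>X. \<pi> x = x" using unit by blast
    moreover from this have "identity_matrix X = perm_matrix X \<pi>"
      by (auto simp: identity_matrix_def perm_matrix_def fun_eq_iff)
    ultimately show ?thesis by blast
  qed
  moreover have "transpose_matrix A \<in> ?T" if A: "A \<in> ?T" for A
  proof -
    obtain \<pi> where \<pi>: "\<pi> \<in> \<Gamma>" "A = perm_matrix X \<pi>" using A by blast
    obtain \<rho> where \<rho>: "\<rho> \<in> \<Gamma>" "\<forall>x\<in>X. \<rho> (\<pi> x) = x \<and> \<pi> (\<rho> x) = x" using inverse \<pi> by blast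
    have "transpose_matrix A = perm_matrix X \<rho>"
      unfolding \<pi>(2) by (rule transpose_perm_matrix) (use maps \<pi> \<rho> in auto)
    then show ?thesis using \<rho> by blast
  qed
  moreover have "matrix_mult X A B \<in> ?T" if AB: "A \<in> ?T" "B \<in> ?T" for A B
  proof -
    obtain \<pi> \<rho> where *: "\<pi> \<in> \<Gamma>" "A = perm_matrix X \<pi>" "\<rho> \<in> \<Gamma>" "B = perm_matrix X \<rho>" using AB by blast
    then obtain \<tau> where \<tau>: "\<tau> \<in> \<Gamma>" "\<forall>x\<in>X. \<tau> x = \<rho> (\<pi> x)" using closed by blast
    have "matrix_mult X A B = perm_matrix X (\<lambda>x. \<rho> (\<pi> x))"
      using * maps by (simp add: mult_perm_matrices [OF fin(1)])
    also have "\<dots> = perm_matrix X \<tau>" by (rule perm_matrix_cong) (use \<tau> in auto)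
    finally show ?thesis using \<tau> by blast
  qed
  then have "matrix_mult X A B = (\<lambda>x y. \<Sum>C\<in>?T. (if C = matrix_mult X A B then 1 else 0) * C x y)"
    if "A \<in> ?T" "B \<in> ?T" for A B
    using that T(1) by (simp add: if_distrib [of "\<lambda>t. t * _"] cong: if_cong)
  moreover have "(if C = matrix_mult X A B then 1 else 0 :: complex) \<in> \<nat>" for A B C
    by simp
  ultimately show ?thesis
    unfolding association_scheme_def
    using fin T partition_matrices_iff [OF T] part
    by (intro conjI ballI exI [of _ "\<lambda>A B C. if C = matrix_mult X A B then 1 else 0"]) simp_all
qed

section \<open>Combinatorial isomorphism\<close>

lemma combinatorially_isomorphic_refl:
  assumes "S \<subseteq> matrices X"
  shows "combinatorially_isomorphic X S X S"
proof -
  have "relabel X X id A = A" if "A \<in> S" for A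
    using that assms by (auto simp: relabel_def matrices_def inv_into_f_f [of id, simplified] fun_eq_iff)
  then show ?thesis
    unfolding combinatorially_isomorphic_def by (intro exI [of _ id]) auto
qed

lemma relabel_trans:
  assumes f: "bij_betw f X Y" and g: "bij_betw g Y Z"
  shows "relabel Y Z g (relabel X Y f A) = relabel X Z (g \<circ> f) A"
proof (intro ext)
  fix u v
  have inv: "inv_into X (g \<circ> f) w = inv_into X f (inv_into Y g w)" "inv_into Y g w \<in> Y" if "w \<in> Z" for w
  proof -
    show "inv_into Y g w \<in> Y" using g that by (metis bij_betw_imp_surj_on inv_into_into)
    have "f ` X = Y" "g ` Y = Z" "inj_on f X" "inj_on g Y" using f g by (auto simp: bij_betw_def)
    then show "inv_into X (g \<circ> f) w = inv_into X f (inv_into Y g w)"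
      using that inv_into_comp [of g f X w] by simp
  qed
  show "relabel Y Z g (relabel X Y f A) u v = relabel X Z (g \<circ> f) A u v"
    using inv by (simp add: relabel_def)
qed

lemma combinatorially_isomorphic_trans:
  assumes "combinatorially_isomorphic X S Y T" "combinatorially_isomorphic Y T Z U"
  shows "combinatorially_isomorphic X S Z U"
proof -
  obtain f g where fg: "bij_betw f X Y" "relabel X Y f ` S = T" "bij_betw g Y Z" "relabel Y Z g ` T = U"
    using assms unfolding combinatorially_isomorphic_def by blast
  have "relabel X Z (g \<circ> f) ` S = relabel Y Z g ` relabel X Y f ` S"
    unfolding image_image relabel_trans [OF fg(1,3)] ..
  then show ?thesis
    unfolding combinatorially_isomorphic_def using bij_betw_trans [OF fg(1,3)] fg by blast
qed

lemma combinatorially_isomorphic_card: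
  "combinatorially_isomorphic X S Y T \<Longrightarrow> card X = card Y"
  unfolding combinatorially_isomorphic_def using bij_betw_same_card by blast

text \<open>
  Mapping classes into classes is enough: every class of \<open>T\<close> is nonempty, so it contains the image
  of some pair of points, and then it is the image of the class of that pair.
\<close>

lemma combinatorially_isomorphicI:
  assumes S: "partition_matrices X S" and T: "partition_matrices Y T" "(\<lambda>x y. 0) \<notin> T"
    and f: "bij_betw f X Y"
    and corr: "\<And>A. A \<in> S \<Longrightarrow> \<exists>B\<in>T. \<forall>x\<in>X. \<forall>y\<in>X. A x y = B (f x) (f y)"
  shows "combinatorially_isomorphic X S Y T"
proof -
  have inv: "inv_into X f u \<in> X" "f (inv_into X f u) = u" if "u \<in> Y" for u
    using f that by (metis bij_betw_imp_surj_on inv_into_into, metis bij_betw_inv_into_right)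
  have rel: "relabel X Y f A = B"
    if "B \<in> T" "\<forall>x\<in>X. \<forall>y\<in>X. A x y = B (f x) (f y)" for A B
  proof (intro ext)
    fix u v
    have "B u v = 0" if "\<not> (u \<in> Y \<and> v \<in> Y)"
      using T(1) \<open>B \<in> T\<close> zero_one_cases [of B Y u v] that by (auto simp: partition_matrices_def)
    then show "relabel X Y f A u v = B u v"
      using that inv by (auto simp: relabel_def)
  qed
  have "relabel X Y f ` S \<subseteq> T" using corr rel by auto blast
  moreover have "B \<in> relabel X Y f ` S" if B: "B \<in> T" for B
  proof -
    obtain u v where uv: "B u v \<noteq> 0" using T(2) B by (metis ext)
    have "u \<in> Y" "v \<in> Y" "B u v = 1"
      using T(1) B uv zero_one_cases [of B Y u v] by (auto simp: partition_matrices_def)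
    note uv = this
    obtain A where A: "A \<in> S" "A (inv_into X f u) (inv_into X f v) = 1"
      using S inv uv unfolding partition_matrices_def by blast
    obtain B' where B': "B' \<in> T" "\<forall>x\<in>X. \<forall>y\<in>X. A x y = B' (f x) (f y)" using corr A by blast
    then have "B' u v = 1" using A inv uv by metis
    then have "B' = B" using partition_entry [OF T(1) B uv(3) B'(1)] by (auto split: if_splits)
    then show ?thesis using rel [OF B'] A by blast
  qed
  ultimately show ?thesis
    unfolding combinatorially_isomorphic_def using f by blast
qed

section \<open>The scheme of an admissible pair in terms of permutations\<close>

definition swap :: "(int \<times> 'a) \<times> nat \<Rightarrow> (int \<times> 'a) \<times> nat" where
  "swap x = (fst x, 1 - snd x)"

text \<open>
  The power of \<open>swap\<close> with exponent \<open>b\<close> modulo 2; composition then adds exponents, see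
  \<open>twist_twist\<close> below.
\<close>

definition twist :: "bool \<Rightarrow> (int \<times> 'a) \<times> nat \<Rightarrow> (int \<times> 'a) \<times> nat" where
  "twist b x = (if b then swap x else x)"

abbreviation side :: "(int \<times> 'a) \<times> nat \<Rightarrow> int" where "side x \<equiv> fst (fst x)"
abbreviation pos :: "(int \<times> 'a) \<times> nat \<Rightarrow> 'a" where "pos x \<equiv> snd (fst x)"

lemma scheme_points_iff:
  "x \<in> scheme_points G \<longleftrightarrow> (side x = 0 \<or> side x = 1) \<and> pos x \<in> carrier G \<and> (snd x = 0 \<or> snd x = 1)"
  by (cases x) (auto simp: scheme_points_def carrier_integer_mod_group)

lemma swap_simps [simp]: "side (swap x) = side x" "pos (swap x) = pos x" "snd (swap x) = 1 - snd x"
  by (simp_all add: swap_def)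

lemma twist_simps [simp]: "side (twist b x) = side x" "pos (twist b x) = pos x"
  by (simp_all add: twist_def)

lemma twist_closed: "x \<in> scheme_points G \<Longrightarrow> twist b x \<in> scheme_points G"
  by (auto simp: scheme_points_iff twist_def)

lemma twist_twist: "x \<in> scheme_points G \<Longrightarrow> twist b (twist c x) = twist (b \<noteq> c) x"
  by (auto simp: scheme_points_iff twist_def swap_def prod_eq_iff)

lemma twist_False [simp]: "twist False x = x"
  by (simp add: twist_def)

lemma same_fibre_twist:
  assumes "x \<in> scheme_points G" "y \<in> scheme_points G" "fst x = fst y"
  shows "\<exists>b. y = twist b x"
  by (rule exI [of _ "snd x \<noteq> snd y"])
    (use assms in \<open>auto simp: scheme_points_iff twist_def swap_def prod_eq_iff\<close>)

lemma twist_inject: "x \<in> scheme_points G \<Longrightarrow> twist b x = twist c x \<longleftrightarrow> b = c"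
  by (auto simp: scheme_points_iff twist_def swap_def prod_eq_iff)

lemma twist_decompose: "y = twist b x \<Longrightarrow> y = twist (y \<noteq> x) x"
  by (cases "y = x") (auto simp: twist_def split: if_splits)

lemma two_set_matrices:
  "I2 i j = (if i \<in> two_set \<and> i = j then 1 else 0)"
  "J2 i j = (if i \<in> two_set \<and> j \<in> two_set then 1 else 0)"
  "K2 i j = (if i \<in> two_set \<and> j \<in> two_set \<and> i \<noteq> j then 1 else 0)"
  by (auto simp: K2_def I2_def J2_def identity_matrix_def all_one_matrix_def)

lemma two_set_products:
  "matrix_mult two_set I2 K2 = K2" "matrix_mult two_set K2 K2 = I2"
  by (auto simp: fun_eq_iff matrix_mult_def two_set_matrices)

lemma block_sum_entry:
  assumes "finite (carrier G)"
  shows "block_sum G s t L x y =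
    (if pos x \<in> carrier G \<and> pos y = pos x \<otimes>\<^bsub>G\<^esub> t
     then (if side x = 0 \<and> side y = s then L (pos x) (pos y) (snd x) (snd y) else 0) +
          (if side x = 1 \<and> side y = (1 + s) mod 2 then L (pos y) (pos x) (snd x) (snd y) else 0)
     else 0)"
proof -
  obtain a k i where x: "x = ((a, k), i)" by (metis surj_pair)
  obtain b l j where y: "y = ((b, l), j)" by (metis surj_pair)
  have "(\<Sum>g\<in>carrier G. kronecker (matrix_unit (c, g) (r, g \<otimes>\<^bsub>G\<^esub> t)) (N g) x y) =
      (if k \<in> carrier G then if a = c \<and> b = r \<and> l = k \<otimes>\<^bsub>G\<^esub> t then N k i j else 0 else 0)" for c r N
  proof -
    have "(\<Sum>g\<in>carrier G. kronecker (matrix_unit (c, g) (r, g \<otimes>\<^bsub>G\<^esub> t)) (N g) x y) =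
      (\<Sum>g\<in>carrier G. if g = k then if a = c \<and> b = r \<and> l = k \<otimes>\<^bsub>G\<^esub> t then N k i j else 0 else 0)"
      by (rule sum.cong) (auto simp: x y kronecker_def matrix_unit_def)
    then show ?thesis using assms by simp
  qed
  from this [of 0 s "\<lambda>g. L g (g \<otimes>\<^bsub>G\<^esub> t)"] this [of 1 "(1 + s) mod 2" "\<lambda>g. L (g \<otimes>\<^bsub>G\<^esub> t) g"]
  show ?thesis
    unfolding block_sum_def by (auto simp: x y)
qed

locale admissible = elementary_2_group G for G (structure) +
  fixes M :: "'a \<Rightarrow> 'a \<Rightarrow> int"
  assumes nontrivial: "carrier G \<noteq> {\<one>}"
    and sign: "x \<in> carrier G \<Longrightarrow> y \<in> carrier G \<Longrightarrow> M x y \<in> {1, -1}"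
    and alternating: "x \<in> carrier G \<Longrightarrow> y \<in> carrier G \<Longrightarrow> z \<in> carrier G \<Longrightarrow> x \<noteq> y \<Longrightarrow>
      M x (x \<otimes> z) * M x (y \<otimes> z) * M y (x \<otimes> z) * M y (y \<otimes> z) = -1"

lemma admissible_pair_iff: "admissible_pair G M \<longleftrightarrow> admissible G M"
  unfolding admissible_pair_def admissible_def admissible_axioms_def elementary_2_group_iff
  by blast

context admissible
begin

abbreviation X :: "((int \<times> 'a) \<times> nat) set" where "X \<equiv> scheme_points G"
abbreviation S :: "((int \<times> 'a) \<times> nat) cmatrix set" where "S \<equiv> scheme_matrices G M"

lemmas twist_closed = twist_closed [of _ G]
  and twist_twist = twist_twist [of _ G]
  and twist_inject = twist_inject [of _ G]

text \<open>
  The sign matrix in additive notation.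
\<close>

definition neg :: "'a \<Rightarrow> 'a \<Rightarrow> bool" where "neg x y \<longleftrightarrow> M x y \<noteq> 1"

lemma second_difference_neg: "second_difference True neg"
  unfolding second_difference_def
proof (intro ballI impI)
  fix x a d assume c: "x \<in> carrier G" "a \<in> carrier G" "d \<in> carrier G" and "True \<longrightarrow> d \<noteq> \<one>"
  then have "x \<noteq> x \<otimes> d" by (simp add: fixed_iff)
  then have "M x a * M x (a \<otimes> d) * M (x \<otimes> d) a * M (x \<otimes> d) (a \<otimes> d) = -1"
    using alternating [of x "x \<otimes> d" "x \<otimes> a"] c by (simp add: ac)
  moreover have "M x a \<in> {1, -1}" "M x (a \<otimes> d) \<in> {1, -1}" "M (x \<otimes> d) a \<in> {1, -1}"
    "M (x \<otimes> d) (a \<otimes> d) \<in> {1, -1}"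
    using sign c by simp_all
  ultimately show "((neg x a \<noteq> neg x (a \<otimes> d)) \<noteq> (neg (x \<otimes> d) a \<noteq> neg (x \<otimes> d) (a \<otimes> d))) = True"
    unfolding neg_def by auto
qed

lemma finite_points: "finite X"
  using finite_carrier by (simp add: scheme_points_def carrier_integer_mod_group)

lemma card_points: "card X = 4 * order G"
  by (simp add: scheme_points_def carrier_integer_mod_group card_cartesian_product order_def)

text \<open>
  The involution whose permutation matrix is \<open>sigma G M 1 t\<close>. The sign matrix is read with the row
  index from side 0 and the column index from side 1, whichever end is the argument.
\<close>

definition cross :: "'a \<Rightarrow> (int \<times> 'a) \<times> nat \<Rightarrow> (int \<times> 'a) \<times> nat" where
  "cross t x = twist (if side x = 0 then neg (pos x) (pos x \<otimes> t) else neg (pos x \<otimes> t) (pos x))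
     ((1 - side x, pos x \<otimes> t), snd x)"

lemma cross_simps [simp]: "side (cross t x) = 1 - side x" "pos (cross t x) = pos x \<otimes> t"
  by (simp_all add: cross_def)

lemma cross_closed: "x \<in> X \<Longrightarrow> t \<in> carrier G \<Longrightarrow> cross t x \<in> X"
  unfolding cross_def by (rule twist_closed) (auto simp: scheme_points_iff)

lemma cross_twist: "x \<in> X \<Longrightarrow> cross t (twist b x) = twist b (cross t x)"
  by (auto simp: cross_def twist_def swap_def scheme_points_iff)

lemma cross_cross: "x \<in> X \<Longrightarrow> t \<in> carrier G \<Longrightarrow> cross t (cross t x) = x"
  by (auto simp: cross_def twist_def swap_def scheme_points_iff ac prod_eq_iff)

text \<open>
  This is the sign condition: passing from \<open>pos x\<close> to \<open>pos x \<otimes> t \<otimes> u\<close> along the two paths through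
  the other side picks up the four signs of a second difference with shift \<open>t \<otimes> u\<close>.
\<close>

lemma cross_anticommute:
  assumes "x \<in> X" "t \<in> carrier G" "u \<in> carrier G" "t \<noteq> u"
  shows "cross u (cross t x) = twist True (cross t (cross u x))"
proof -
  obtain s g i where x: "x = ((s, g), i)" by (metis surj_pair)
  have g: "g \<in> carrier G" "s = 0 \<or> s = 1" "i = 0 \<or> i = 1"
    using assms by (auto simp: x scheme_points_iff)
  have ne: "t \<otimes> u \<noteq> \<one>" using assms by (simp add: mult_eq_one_iff)
  have p1: "(neg g (g \<otimes> t) \<noteq> neg g (g \<otimes> u)) \<noteq>
      (neg (g \<otimes> (t \<otimes> u)) (g \<otimes> t) \<noteq> neg (g \<otimes> (t \<otimes> u)) (g \<otimes> u))"
    using second_difference_neg [unfolded second_difference_def, THEN bspec, THEN bspec, THEN bspec,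
        of g "g \<otimes> t" "t \<otimes> u"] g ne assms by (simp add: ac)
  have p2: "(neg (g \<otimes> t) g \<noteq> neg (g \<otimes> u) g) \<noteq>
      (neg (g \<otimes> t) (g \<otimes> (t \<otimes> u)) \<noteq> neg (g \<otimes> u) (g \<otimes> (t \<otimes> u)))"
    using second_difference_neg [unfolded second_difference_def, THEN bspec, THEN bspec, THEN bspec,
        of "g \<otimes> t" g "t \<otimes> u"] g ne assms by (simp add: ac) argo
  have ac': "(g \<otimes> t) \<otimes> u = g \<otimes> (t \<otimes> u)" "(g \<otimes> u) \<otimes> t = g \<otimes> (t \<otimes> u)"
    using g assms by (simp_all add: m_ac)
  show ?thesis
    using g(2)
  proof
    assume "s = 0"
    then show ?thesis
      using p1 g(3) by (auto simp: x cross_def twist_def swap_def ac')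
  next
    assume "s = 1"
    then show ?thesis
      using p2 g(3) by (auto simp: x cross_def twist_def swap_def ac')
  qed
qed

text \<open>
  For \<open>t \<noteq> \<one>\<close> this is \<open>sigma G M 0 t\<close>; for \<open>t = \<one>\<close> it is the sum of the identity and the swap,
  which gives products a uniform description.
\<close>

definition fibre :: "'a \<Rightarrow> ((int \<times> 'a) \<times> nat) cmatrix" where
  "fibre t = (\<lambda>x y. if x \<in> X \<and> y \<in> X \<and> side x = side y \<and> pos y = pos x \<otimes> t then 1 else 0)"

abbreviation twist_matrix :: "bool \<Rightarrow> ((int \<times> 'a) \<times> nat) cmatrix" where
  "twist_matrix b \<equiv> perm_matrix X (twist b)"

abbreviation cross_matrix :: "bool \<Rightarrow> 'a \<Rightarrow> ((int \<times> 'a) \<times> nat) cmatrix" where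
  "cross_matrix b t \<equiv> perm_matrix X (\<lambda>x. twist b (cross t x))"

lemma sigma_generator:
  assumes "t \<in> carrier G"
  shows "sigma G M 1 t = cross_matrix False t" "sigma' G M 1 t = cross_matrix True t"
proof -
  have L: "L_block G M 1 t x y = (if neg x y then K2 else I2)" for x y
    by (simp add: L_block_def neg_def)
  have LK: "matrix_mult two_set (L_block G M 1 t x y) K2 = (if neg x y then I2 else K2)" for x y
    unfolding L by (cases "neg x y") (simp_all only: if_True if_False two_set_products)
  show "sigma G M 1 t = cross_matrix False t"
    unfolding sigma_def using assms
    by (intro ext) (auto simp: block_sum_entry [OF finite_carrier] L perm_matrix_def scheme_points_iff
        cross_def twist_def swap_def prod_eq_iff two_set_matrices)
  show "sigma' G M 1 t = cross_matrix True t"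
    unfolding sigma'_def LK using assms
    by (intro ext) (auto simp: block_sum_entry [OF finite_carrier] perm_matrix_def scheme_points_iff
        cross_def twist_def swap_def prod_eq_iff two_set_matrices)
qed

lemma sigma_identity:
  shows "sigma G M 0 \<one> = twist_matrix False" "sigma' G M 0 \<one> = twist_matrix True"
    "t \<in> carrier G \<Longrightarrow> t \<noteq> \<one> \<Longrightarrow> sigma G M 0 t = fibre t"
proof -
  have L: "L_block G M 0 t x y = (if t = \<one> then I2 else J2)" for x y t
    by (simp add: L_block_def)
  have LK: "matrix_mult two_set (L_block G M 0 \<one> x y) K2 = K2" for x y
    unfolding L by (simp only: simp_thms if_True two_set_products)
  show "sigma G M 0 \<one> = twist_matrix False"
    unfolding sigma_def
    by (intro ext) (auto simp: block_sum_entry [OF finite_carrier] L perm_matrix_def scheme_points_iff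
        twist_def swap_def prod_eq_iff two_set_matrices)
  show "sigma' G M 0 \<one> = twist_matrix True"
    unfolding sigma'_def LK
    by (intro ext) (auto simp: block_sum_entry [OF finite_carrier] perm_matrix_def
        scheme_points_iff twist_def swap_def prod_eq_iff two_set_matrices)
  show "sigma G M 0 t = fibre t" if "t \<in> carrier G" "t \<noteq> \<one>"
    unfolding sigma_def using that
    by (intro ext) (auto simp: block_sum_entry [OF finite_carrier] L fibre_def scheme_points_iff
        prod_eq_iff two_set_matrices)
qed

lemma scheme_matrices_eq:
  "S = range twist_matrix \<union> {cross_matrix b t | b t. t \<in> carrier G} \<union>
     {fibre t | t. t \<in> carrier G \<and> t \<noteq> \<one>}"
proof -
  have "S = {twist_matrix False, twist_matrix True} \<union>
     {fibre t | t. t \<in> carrier G \<and> t \<noteq> \<one>} \<union>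
     ({cross_matrix False t | t. t \<in> carrier G} \<union> {cross_matrix True t | t. t \<in> carrier G})"
    unfolding scheme_matrices_def one_integer_mod_group sigma_identity(1,2)
    using sigma_generator sigma_identity(3) by (intro arg_cong2 [of _ _ _ _ "(\<union>)"] Collect_cong) metis+
  also have "{cross_matrix False t | t. t \<in> carrier G} \<union> {cross_matrix True t | t. t \<in> carrier G} =
      {cross_matrix b t | b t. t \<in> carrier G}"
    by (simp add: set_eq_iff ex_bool_eq) blast
  also have "{twist_matrix False, twist_matrix True} = range twist_matrix"
    by (auto simp: UNIV_bool)
  finally show ?thesis by blast
qed

lemma scheme_cases [consumes 1, case_names twist cross fibre]:
  assumes "A \<in> S"
  obtains b where "A = twist_matrix b"
  | b t where "t \<in> carrier G" "A = cross_matrix b t"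
  | t where "t \<in> carrier G" "t \<noteq> \<one>" "A = fibre t"
  using assms unfolding scheme_matrices_eq
  by (elim UnE rangeE CollectE exE conjE) (rule that; assumption)+

lemma scheme_members:
  "twist_matrix b \<in> S" "t \<in> carrier G \<Longrightarrow> cross_matrix b t \<in> S"
  "t \<in> carrier G \<Longrightarrow> t \<noteq> \<one> \<Longrightarrow> fibre t \<in> S"
  unfolding scheme_matrices_eq
  by (rule UnI1, rule UnI1, rule rangeI) (rule UnI1, rule UnI2, rule CollectI, intro exI conjI, rule refl, assumption,
    rule UnI2, rule CollectI, intro exI conjI, rule refl, assumption, assumption)

lemma finite_scheme: "finite S"
proof -
  have "{cross_matrix b t | b t. t \<in> carrier G} = (\<lambda>(b, t). cross_matrix b t) ` (UNIV \<times> carrier G)"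
    by auto
  moreover have "{fibre t | t. t \<in> carrier G \<and> t \<noteq> \<one>} = fibre ` (carrier G - {\<one>})"
    by auto
  ultimately show ?thesis
    unfolding scheme_matrices_eq using finite_carrier by simp
qed

lemma fibre_zero_one: "fibre t \<in> zero_one_matrices X"
  by (auto simp: fibre_def zero_one_matrices_def matrices_def)

lemma scheme_zero_one: "S \<subseteq> zero_one_matrices X"
proof
  fix A assume "A \<in> S"
  then show "A \<in> zero_one_matrices X"
    by (cases rule: scheme_cases) (simp_all only: perm_matrix_zero_one fibre_zero_one)
qed

lemma same_side_twist:
  assumes "x \<in> X" "y \<in> X" "side x = side y" "pos x = pos y"
  shows "\<exists>b. y = twist b x"
  by (rule same_fibre_twist [of _ G]) (use assms in \<open>simp_all add: prod_eq_iff\<close>)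

lemma other_side_cross:
  assumes "x \<in> X" "y \<in> X" "side x \<noteq> side y"
  shows "\<exists>b. y = twist b (cross (pos x \<otimes> pos y) x)"
proof (rule same_fibre_twist [of _ G])
  have c: "pos x \<in> carrier G" "pos y \<in> carrier G" using assms by (auto simp: scheme_points_iff)
  then show "cross (pos x \<otimes> pos y) x \<in> X" using assms cross_closed by simp
  show "fst (cross (pos x \<otimes> pos y) x) = fst y"
    using assms c by (auto simp: prod_eq_iff scheme_points_iff ac)
qed (rule assms)

text \<open>
  The class that contains a given pair of points.
\<close>

definition colour :: "(int \<times> 'a) \<times> nat \<Rightarrow> (int \<times> 'a) \<times> nat \<Rightarrow> ((int \<times> 'a) \<times> nat) cmatrix" where
  "colour x y = (if side x \<noteq> side y then cross_matrix (y \<noteq> cross (pos x \<otimes> pos y) x) (pos x \<otimes> pos y)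
     else if pos x = pos y then twist_matrix (y \<noteq> x) else fibre (pos x \<otimes> pos y))"

lemma scheme_entry_iff:
  assumes "x \<in> X" "y \<in> X" "A \<in> S"
  shows "A x y = 1 \<longleftrightarrow> A = colour x y"
proof -
  have c: "pos x \<in> carrier G" "pos y \<in> carrier G" using assms by (auto simp: scheme_points_iff)
  have one: "colour x y x y = 1"
  proof (cases "side x = side y")
    case same: True
    show ?thesis
    proof (cases "pos x = pos y")
      case True
      then obtain b where "y = twist b x"
        using same_side_twist [OF assms(1,2) same] by blast
      then have "y = twist (y \<noteq> x) x" by (rule twist_decompose)
      then show ?thesis using True same assms by (simp add: colour_def perm_matrix_def)
    next
      case False
      then show ?thesis using same assms c by (simp add: colour_def fibre_def square_left)
    qed
  next
    case False
    then obtain b where "y = twist b (cross (pos x \<otimes> pos y) x)"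
      using other_side_cross [OF assms(1,2)] by blast
    then have "y = twist (y \<noteq> cross (pos x \<otimes> pos y) x) (cross (pos x \<otimes> pos y) x)"
      by (rule twist_decompose)
    then show ?thesis using False assms by (simp add: colour_def perm_matrix_def)
  qed
  have "A = colour x y" if "A x y = 1"
    using assms(3)
  proof (cases rule: scheme_cases)
    case (twist b)
    then have "y = twist b x" using that by (auto simp: perm_matrix_def split: if_splits)
    moreover have "twist b x \<noteq> x \<longleftrightarrow> b" using twist_inject [OF assms(1), of b False] by simp
    ultimately show ?thesis using twist by (simp add: colour_def)
  next
    case (cross b t)
    then have y: "y = twist b (cross t x)" using that by (auto simp: perm_matrix_def split: if_splits)
    moreover have "pos x \<otimes> pos y = t" using y c cross by (simp add: square_left)
    moreover have "twist b (cross t x) \<noteq> cross t x \<longleftrightarrow> b"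
      using twist_inject [OF cross_closed [OF assms(1) cross(1)], of b False] by simp
    moreover have "side x \<noteq> side y" using y assms(1) by (auto simp: scheme_points_iff)
    ultimately show ?thesis using cross by (simp add: colour_def)
  next
    case (fibre t)
    then have y: "side x = side y" "pos y = pos x \<otimes> t" using that by (auto simp: fibre_def split: if_splits)
    moreover have "pos x \<otimes> pos y = t" using y c fibre by (simp add: square_left)
    moreover have "pos x \<noteq> pos y" using y c fibre fixed_iff by metis
    ultimately show ?thesis using fibre by (simp add: colour_def)
  qed
  then show ?thesis using one by blast
qed

lemma colour_in_scheme:
  assumes "x \<in> X" "y \<in> X"
  shows "colour x y \<in> S"
proof -
  have c: "pos x \<in> carrier G" "pos y \<in> carrier G" using assms by (auto simp: scheme_points_iff)
  then show ?thesis
    by (simp add: colour_def scheme_members mult_eq_one_iff)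
qed

lemma scheme_partition: "partition_matrices X S"
  unfolding partition_matrices_def
proof (intro conjI ballI)
  fix x y assume "x \<in> X" "y \<in> X"
  then show "\<exists>!A. A \<in> S \<and> A x y = 1"
    using colour_in_scheme [of x y] scheme_entry_iff [of x y] by (intro ex1I [of _ "colour x y"]) auto
qed (rule finite_scheme scheme_zero_one)+

lemma scheme_symmetric:
  assumes "A \<in> S"
  shows "transpose_matrix A = A"
  using assms
proof (cases rule: scheme_cases)
  case (twist b)
  then show ?thesis
    by (simp, intro transpose_perm_matrix) (auto simp: twist_closed twist_twist)
next
  case (cross b t)
  then show ?thesis
    by (simp, intro transpose_perm_matrix) (auto simp: twist_closed cross_closed cross_twist cross_cross twist_twist)
next
  case (fibre t)
  have "pos y = pos x \<otimes> t \<longleftrightarrow> pos x = pos y \<otimes> t" if "x \<in> X" "y \<in> X" for x y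
    using that fibre(1) by (auto simp: scheme_points_iff ac)
  then have "fibre t y x = fibre t x y" for x y
    unfolding fibre_def by (cases "x \<in> X \<and> y \<in> X") auto
  then show ?thesis
    unfolding fibre(3) by (intro ext) (simp add: transpose_matrix_def)
qed

section \<open>The Jordan scheme property\<close>

lemma span_twist: "integer_span S (twist_matrix b)"
  by (intro integer_span_member finite_scheme scheme_members)

lemma span_cross: "t \<in> carrier G \<Longrightarrow> integer_span S (cross_matrix b t)"
  by (intro integer_span_member finite_scheme scheme_members)

lemma span_fibre:
  assumes "t \<in> carrier G"
  shows "integer_span S (fibre t)"
proof (cases "t = \<one>")
  case True
  have "twist_matrix False x y + twist_matrix True x y = fibre \<one> x y" for x y
    by (auto simp: perm_matrix_def fibre_def scheme_points_iff twist_def swap_def prod_eq_iff)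
  then show ?thesis
    using integer_span_add [OF span_twist [of False] span_twist [of True]] True by simp
next
  case False
  then show ?thesis
    using assms by (intro integer_span_member finite_scheme scheme_members)
qed


lemma fibre_twist:
  assumes "x \<in> X" "y \<in> X"
  shows "fibre t (twist b x) y = fibre t x y" "fibre t x (twist b y) = fibre t x y"
  using assms by (simp_all add: fibre_def twist_closed)

text \<open>
  The two points of a fibre are \<open>w\<close> and its swap, so adding their indicators forgets the last
  coordinate.
\<close>

lemma twist_pair_fibre:
  assumes "x \<in> X" "y \<in> X" "w \<in> X"
    "side w = side x" "pos w = pos x \<otimes> t"
  shows "(if y = twist b w then 1 else 0) + (if y = twist (\<not> b) w then 1 else 0) = fibre t x y"
proof (cases "side y = side w \<and> pos y = pos w")
  case True
  then obtain c where c: "y = twist c w" using same_side_twist [of w y] assms by auto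
  then have "y = twist b w \<longleftrightarrow> c = b" "y = twist (\<not> b) w \<longleftrightarrow> c = (\<not> b)"
    by (simp_all only: twist_inject [OF assms(3)])
  then show ?thesis
    using assms True by (simp add: fibre_def)
next
  case False
  then have "y \<noteq> twist b w" "y \<noteq> twist (\<not> b) w" by auto
  then show ?thesis using False assms by (auto simp: fibre_def)
qed

text \<open>
  A fibre matrix is the sum of a shift and its swap, each of which moves the second factor to
  \<open>fibre (t \<otimes> u)\<close>.
\<close>

lemma fibre_mult_fibre:
  assumes t: "t \<in> carrier G" "u \<in> carrier G" and xy: "x \<in> X" "y \<in> X"
  shows "matrix_mult X (fibre t) (fibre u) x y = 2 * fibre (t \<otimes> u) x y"
proof -
  define shift where "shift x = ((side x, pos x \<otimes> t), snd x)" for x :: "(int \<times> 'a) \<times> nat"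
  have shift: "shift x \<in> X" if "x \<in> X" for x
    using that t by (simp add: shift_def scheme_points_iff)
  have "fibre t = (\<lambda>x y. perm_matrix X (\<lambda>x. twist False (shift x)) x y +
      perm_matrix X (\<lambda>x. twist True (shift x)) x y)"
  proof (intro ext)
    fix x y
    show "fibre t x y = perm_matrix X (\<lambda>x. twist False (shift x)) x y +
      perm_matrix X (\<lambda>x. twist True (shift x)) x y"
    proof (cases "x \<in> X \<and> y \<in> X")
      case True
      then show ?thesis
        using twist_pair_fibre [of x y "shift x" t False] shift [of x]
        by (simp add: perm_matrix_def shift_def)
    next
      case False
      then show ?thesis by (auto simp: fibre_def perm_matrix_def)
    qed
  qed
  then have "matrix_mult X (fibre t) (fibre u) x y =
      fibre u (twist False (shift x)) y + fibre u (twist True (shift x)) y"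
    using xy shift twist_closed [OF shift]
    by (simp only: matrix_mult_add_left mult_perm_matrix_left finite_points)
  also have "\<dots> = 2 * fibre u (shift x) y"
    using xy shift by (simp add: fibre_twist)
  also have "fibre u (shift x) y = fibre (t \<otimes> u) x y"
    using xy shift t by (simp add: fibre_def shift_def scheme_points_iff m_assoc)
  finally show ?thesis .
qed

lemma cross_pair:
  assumes "x \<in> X" "y \<in> X" "t \<in> carrier G"
  shows "cross_matrix False t x y + cross_matrix True t x y =
    (if side x \<noteq> side y \<and> pos y = pos x \<otimes> t then 1 else 0)"
proof -
  have c: "cross t x \<in> X" using assms cross_closed by blast
  have "(side x = 0 \<or> side x = 1) \<and> (side y = 0 \<or> side y = 1)" and pos: "pos x \<in> carrier G"
    using assms by (auto simp: scheme_points_iff)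
  then have sides: "1 - side x = side y \<longleftrightarrow> side x \<noteq> side y"
    by (elim conjE disjE) simp_all
  have "cross_matrix False t x y + cross_matrix True t x y = fibre \<one> (cross t x) y"
    using twist_pair_fibre [OF c assms(2) c refl, of \<one> False] c assms
    by (simp add: perm_matrix_def scheme_points_iff)
  also have "\<dots> = (if side x \<noteq> side y \<and> pos y = pos x \<otimes> t then 1 else 0)"
    using c assms sides pos by (simp add: fibre_def)
  finally show ?thesis .
qed

lemma fibre_mult_cross:
  assumes "t \<in> carrier G" "u \<in> carrier G" "x \<in> X" "y \<in> X"
  shows "matrix_mult X (cross_matrix b t) (fibre u) x y =
      (if side x \<noteq> side y \<and> pos y = pos x \<otimes> (t \<otimes> u) then 1 else 0)"
    "matrix_mult X (fibre u) (cross_matrix b t) x y =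
      (if side x \<noteq> side y \<and> pos y = pos x \<otimes> (t \<otimes> u) then 1 else 0)"
proof -
  have c: "pos x \<in> carrier G" "pos y \<in> carrier G" "side x = 0 \<or> side x = 1" "side y = 0 \<or> side y = 1"
    using assms by (auto simp: scheme_points_iff)
  have sides: "1 - side x = side y \<longleftrightarrow> side x \<noteq> side y" "side x = 1 - side y \<longleftrightarrow> side x \<noteq> side y"
    using c(3,4) by (elim disjE; simp)+
  have cl: "twist b (cross t z) \<in> X" if "z \<in> X" for z
    using that assms cross_closed twist_closed by blast
  have inv: "twist b (cross t (twist b (cross t z))) = z" if "z \<in> X" for z
    using that assms cross_closed [of _ t] by (simp add: cross_twist cross_cross twist_twist)
  have e: "pos y = pos x \<otimes> t \<otimes> u \<longleftrightarrow> pos y = pos x \<otimes> (t \<otimes> u)"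
    "pos y \<otimes> t = pos x \<otimes> u \<longleftrightarrow> pos y = pos x \<otimes> (t \<otimes> u)"
  proof -
    show "pos y = pos x \<otimes> t \<otimes> u \<longleftrightarrow> pos y = pos x \<otimes> (t \<otimes> u)"
      using c assms by (simp add: m_assoc)
    have "pos y \<otimes> t = pos x \<otimes> u \<longleftrightarrow> t \<otimes> (pos y \<otimes> t) = t \<otimes> (pos x \<otimes> u)"
      using c assms by simp
    then show "pos y \<otimes> t = pos x \<otimes> u \<longleftrightarrow> pos y = pos x \<otimes> (t \<otimes> u)"
      using c assms by (simp add: ac)
  qed
  show "matrix_mult X (cross_matrix b t) (fibre u) x y =
      (if side x \<noteq> side y \<and> pos y = pos x \<otimes> (t \<otimes> u) then 1 else 0)"
    unfolding mult_perm_matrix_left [where \<pi> = "\<lambda>x. twist b (cross t x)",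
        OF finite_points assms(3) cl [OF assms(3)]]
    using assms cl e sides by (simp add: fibre_def)
  have right: "matrix_mult X (fibre u) (cross_matrix b t) x y = fibre u x (twist b (cross t y))"
    by (rule mult_perm_matrix_right) (simp_all add: finite_points assms cl inv)
  show "matrix_mult X (fibre u) (cross_matrix b t) x y =
      (if side x \<noteq> side y \<and> pos y = pos x \<otimes> (t \<otimes> u) then 1 else 0)"
    unfolding right using assms cl e sides by (simp add: fibre_def)
qed

lemma span_anticommutator:
  assumes "A \<in> S" "B \<in> S" "R \<in> matrices X" "integer_span S R"
    and "\<And>x y. x \<in> X \<Longrightarrow> y \<in> X \<Longrightarrow> matrix_mult X A B x y + matrix_mult X B A x y = R x y"
  shows "integer_span S (\<lambda>x y. matrix_mult X A B x y + matrix_mult X B A x y)"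
proof -
  have m: "A \<in> matrices X" "B \<in> matrices X"
    using assms scheme_zero_one zero_one_in_matrices by blast+
  have "matrix_mult X A B \<in> matrices X" "matrix_mult X B A \<in> matrices X"
    using m by (simp_all add: matrix_mult_in_matrices)
  then have "(\<lambda>x y. matrix_mult X A B x y + matrix_mult X B A x y) \<in> matrices X"
    by (rule add_in_matrices)
  then have "(\<lambda>x y. matrix_mult X A B x y + matrix_mult X B A x y) = R"
    using assms by (intro matrices_eqI)
  then show ?thesis using assms by simp
qed

lemma fibre_in_matrices: "fibre t \<in> matrices X"
  by (intro zero_one_in_matrices fibre_zero_one)

lemma span_perm_product:
  assumes \<pi>: "\<And>x. x \<in> X \<Longrightarrow> \<pi> x \<in> X" and \<rho>: "\<And>x. x \<in> X \<Longrightarrow> \<rho> x \<in> X"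
    and "\<And>x. x \<in> X \<Longrightarrow> \<rho> (\<pi> x) = \<tau> x" "\<And>x. x \<in> X \<Longrightarrow> \<pi> (\<rho> x) = \<tau> x"
    and "integer_span S (perm_matrix X \<tau>)"
  shows "integer_span S (\<lambda>x y. matrix_mult X (perm_matrix X \<pi>) (perm_matrix X \<rho>) x y +
    matrix_mult X (perm_matrix X \<rho>) (perm_matrix X \<pi>) x y)"
proof -
  have "perm_matrix X (\<lambda>x. \<rho> (\<pi> x)) = perm_matrix X \<tau>" "perm_matrix X (\<lambda>x. \<pi> (\<rho> x)) = perm_matrix X \<tau>"
    using assms(3,4) by (intro perm_matrix_cong; simp)+
  then show ?thesis
    using mult_perm_matrices [of X \<pi> \<rho>, OF finite_points \<pi>] mult_perm_matrices [of X \<rho> \<pi>, OF finite_points \<rho>]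
      integer_span_add [OF assms(5) assms(5)] by simp
qed

lemma twist_anticommutator:
  assumes "B \<in> S"
  shows "integer_span S (\<lambda>x y. matrix_mult X (twist_matrix b) B x y + matrix_mult X B (twist_matrix b) x y)"
  using assms
proof (cases rule: scheme_cases)
  case (twist c)
  have xor: "(c = (\<not> b)) = (b = (\<not> c))" by auto
  show ?thesis
    unfolding twist
    by (rule span_perm_product [where \<tau> = "twist (b \<noteq> c)"])
      (simp_all add: twist_closed twist_twist span_twist xor)
next
  case (cross c t)
  have xor: "(c = (\<not> b)) = (b = (\<not> c))" by auto
  show ?thesis
    unfolding cross(2)
    by (rule span_perm_product [where \<tau> = "\<lambda>x. twist (b \<noteq> c) (cross t x)"])
      (use cross in \<open>simp_all add: twist_closed twist_twist cross_closed cross_twist span_cross xor\<close>)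
next
  case (fibre t)
  show ?thesis
  proof (rule span_anticommutator [OF scheme_members(1) assms])
    show "(\<lambda>x y. fibre t x y + fibre t x y) \<in> matrices X"
      by (intro add_in_matrices fibre_in_matrices)
    show "integer_span S (\<lambda>x y. fibre t x y + fibre t x y)"
      using fibre by (intro integer_span_add span_fibre)
    fix x y assume xy: "x \<in> X" "y \<in> X"
    show "matrix_mult X (twist_matrix b) B x y + matrix_mult X B (twist_matrix b) x y =
        fibre t x y + fibre t x y"
      unfolding fibre(3)
      using xy by (subst mult_perm_matrix_left, simp_all add: finite_points twist_closed,
        subst mult_perm_matrix_right [where \<rho> = "twist b"],
        simp_all add: finite_points twist_closed twist_twist fibre_twist)
  qed
qed

text \<open>
  The products of two distinct crossings in the two orders differ by a swap, so neither belongs to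
  the scheme but their sum is a fibre matrix. All other pairs of classes commute.
\<close>

lemma cross_anticommutator:
  assumes "B \<in> S" and t: "t \<in> carrier G"
  shows "integer_span S (\<lambda>x y. matrix_mult X (cross_matrix b t) B x y + matrix_mult X B (cross_matrix b t) x y)"
  using assms(1)
proof (cases rule: scheme_cases)
  case (twist c)
  then show ?thesis
    using twist_anticommutator [OF scheme_members(2) [OF t], of c b] by (simp add: add.commute)
next
  case (cross c u)
  show ?thesis
  proof (cases "t = u")
    case True
    have xor: "(c = (\<not> b)) = (b = (\<not> c))" by auto
    show ?thesis
      unfolding cross(2)
      by (rule span_perm_product [where \<tau> = "twist (b \<noteq> c)"])
        (use cross True in \<open>simp_all add: twist_closed twist_twist cross_closed cross_twist cross_cross span_twist xor\<close>)
  next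
    case False
    show ?thesis
    proof (rule span_anticommutator [OF scheme_members(2) [OF t] assms(1)])
      show "fibre (t \<otimes> u) \<in> matrices X" by (rule fibre_in_matrices)
      show "integer_span S (fibre (t \<otimes> u))" using t cross by (intro span_fibre) simp
      fix x y assume xy: "x \<in> X" "y \<in> X"
      have c: "cross t x \<in> X" "cross u x \<in> X" "cross t (cross u x) \<in> X" "cross u (cross t x) \<in> X"
        using xy t cross cross_closed by simp_all
      have xor: "(c = b) = (b = c)" by auto
      have "twist c (cross u (twist b (cross t x))) = twist (\<not> (b \<noteq> c)) (cross t (cross u x))"
        using c cross_anticommute [OF xy(1) t cross(1) False]
        by (simp add: cross_twist twist_twist xor)
      then have tu: "matrix_mult X (cross_matrix b t) (cross_matrix c u) x y =
          (if y = twist (\<not> (b \<noteq> c)) (cross t (cross u x)) then 1 else 0)"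
        using xy c by (subst mult_perm_matrices_entry) (simp_all only: finite_points twist_closed)
      have "twist b (cross t (twist c (cross u x))) = twist (b \<noteq> c) (cross t (cross u x))"
        using c by (simp add: cross_twist twist_twist)
      then have ut: "matrix_mult X (cross_matrix c u) (cross_matrix b t) x y =
          (if y = twist (b \<noteq> c) (cross t (cross u x)) then 1 else 0)"
        using xy c by (subst mult_perm_matrices_entry) (simp_all only: finite_points twist_closed)
      have "side (cross t (cross u x)) = side x" "pos (cross t (cross u x)) = pos x \<otimes> (t \<otimes> u)"
        using xy t cross(1) by (simp_all add: scheme_points_iff m_ac)
      from twist_pair_fibre [OF xy c(3) this, of "b \<noteq> c"]
      show "matrix_mult X (cross_matrix b t) B x y + matrix_mult X B (cross_matrix b t) x y =
          fibre (t \<otimes> u) x y"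
        unfolding cross(2) tu ut by (simp only: add.commute)
    qed
  qed
next
  case (fibre u)
  let ?R = "\<lambda>x y. cross_matrix False (t \<otimes> u) x y + cross_matrix True (t \<otimes> u) x y"
  show ?thesis
  proof (rule span_anticommutator [OF scheme_members(2) [OF t] assms(1)])
    show "(\<lambda>x y. ?R x y + ?R x y) \<in> matrices X"
      by (intro add_in_matrices perm_in_matrices)
    show "integer_span S (\<lambda>x y. ?R x y + ?R x y)"
      using t fibre by (intro integer_span_add span_cross) simp_all
    fix x y assume xy: "x \<in> X" "y \<in> X"
    have "t \<otimes> u \<in> carrier G" using t fibre by simp
    then show "matrix_mult X (cross_matrix b t) B x y + matrix_mult X B (cross_matrix b t) x y = ?R x y + ?R x y"
      unfolding fibre(3) cross_pair [OF xy \<open>t \<otimes> u \<in> carrier G\<close>]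
      by (simp only: fibre_mult_cross [OF t fibre(1) xy])
  qed
qed

lemma fibre_anticommutator:
  assumes "B \<in> S" and t: "t \<in> carrier G" "t \<noteq> \<one>"
  shows "integer_span S (\<lambda>x y. matrix_mult X (fibre t) B x y + matrix_mult X B (fibre t) x y)"
  using assms(1)
proof (cases rule: scheme_cases)
  case (twist c)
  then show ?thesis
    using twist_anticommutator [OF scheme_members(3) [OF t], of c] by (simp add: add.commute)
next
  case (cross c u)
  then show ?thesis
    using cross_anticommutator [OF scheme_members(3) [OF t] cross(1), of c] by (simp add: add.commute)
next
  case (fibre u)
  let ?R = "\<lambda>x y. fibre (t \<otimes> u) x y + fibre (t \<otimes> u) x y"
  show ?thesis
  proof (rule span_anticommutator [OF scheme_members(3) [OF t] assms(1)])
    show "(\<lambda>x y. ?R x y + ?R x y) \<in> matrices X"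
      by (intro add_in_matrices fibre_in_matrices)
    show "integer_span S (\<lambda>x y. ?R x y + ?R x y)"
      using t fibre by (intro integer_span_add span_fibre) simp_all
    fix x y assume "x \<in> X" "y \<in> X"
    then show "matrix_mult X (fibre t) B x y + matrix_mult X B (fibre t) x y = ?R x y + ?R x y"
      unfolding fibre(3) using t fibre by (simp add: fibre_mult_fibre m_comm)
  qed
qed

theorem scheme_is_jordan: "jordan_scheme X S"
proof (rule jordan_schemeI)
  have "identity_matrix X = twist_matrix False"
    by (auto simp: identity_matrix_def perm_matrix_def fun_eq_iff)
  then show "identity_matrix X \<in> S" using scheme_members by simp
next
  fix A B assume "A \<in> S" "B \<in> S"
  from \<open>A \<in> S\<close> show "integer_span S (\<lambda>x y. matrix_mult X A B x y + matrix_mult X B A x y)"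
  proof (cases rule: scheme_cases)
    case (twist b)
    then show ?thesis using twist_anticommutator [OF \<open>B \<in> S\<close>] by simp
  next
    case (cross b t)
    then show ?thesis using cross_anticommutator [OF \<open>B \<in> S\<close>] by simp
  next
    case (fibre t)
    then show ?thesis using fibre_anticommutator [OF \<open>B \<in> S\<close>] by simp
  qed
qed (rule finite_points scheme_partition scheme_symmetric; assumption)+


section \<open>Properness in orders 16 and 32\<close>

text \<open>
  Assume that an association scheme symmetrizes to the given one. Its classes include all the
  crossings, since these are permutation matrices of involutions, and hence the product \<open>\<tau>\<close> of
  three crossings. Since \<open>\<tau>\<close> exchanges the sides, its symmetrization is one of the involutions
  \<open>cross_matrix b s\<close>, so \<open>\<tau>\<close> itself is an involution. But three pairwise anticommuting involutions
  have a product whose square is the swap. Three different crossings exist as soon as \<open>G\<close> has more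
  than two elements.
\<close>

lemma proper_scheme:
  assumes "order G \<in> {4, 8}"
  shows "proper_jordan_scheme X S"
  unfolding proper_jordan_scheme_def
proof (intro conjI notI)
  show "jordan_scheme X S" by (rule scheme_is_jordan)
  assume "improper_jordan_scheme X S"
  then obtain T where T: "association_scheme X T" "S = symmetrize ` T"
    unfolding improper_jordan_scheme_def by blast
  have "\<exists>g\<in>carrier G. g \<notin> {a, b}" for a b
  proof (rule ccontr)
    assume "\<not> ?thesis"
    then have "carrier G \<subseteq> {a, b}" by blast
    then have "card (carrier G) \<le> card {a, b}" by (intro card_mono) auto
    also have "card {a, b} \<le> 2" by (simp add: card_insert_if)
    finally show False using assms by (auto simp: order_def)
  qed
  then obtain t u where tu: "t \<in> carrier G" "t \<noteq> \<one>" "u \<in> carrier G" "u \<noteq> \<one>" "u \<noteq> t"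
    by (metis insertCI)
  have thin: "perm_matrix X (cross s) \<in> T" if "s \<in> carrier G" for s
  proof (rule thin_of_symmetrization [OF T(1)])
    show "perm_matrix X (cross s) \<in> symmetrize ` T"
      using scheme_members(2) [of s False] that T(2) by simp
  qed (use that in \<open>simp_all add: cross_closed cross_cross\<close>)
  define x0 where "x0 = ((0 :: int, \<one>), 0 :: nat)"
  have x0: "x0 \<in> X" by (simp add: x0_def scheme_points_iff)
  then have ne: "X \<noteq> {}" by blast
  define \<tau> where "\<tau> x = cross u (cross \<one> (cross t x))" for x
  have \<tau>X: "\<tau> x \<in> X" if "x \<in> X" for x
    using that tu by (simp add: \<tau>_def cross_closed)
  have "perm_matrix X (\<lambda>x. cross \<one> (cross t x)) \<in> T"
    by (rule thin_mult [OF T(1) ne, where \<pi> = "cross t" and \<rho> = "cross \<one>"])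
      (use tu in \<open>simp_all add: cross_closed thin\<close>)
  then have "perm_matrix X (\<lambda>x. cross u (cross \<one> (cross t x))) \<in> T"
    by (rule thin_mult [OF T(1) ne, where \<pi> = "\<lambda>x. cross \<one> (cross t x)" and \<rho> = "cross u"])
      (use tu in \<open>simp_all add: cross_closed thin\<close>)
  then have sym: "symmetrize (perm_matrix X \<tau>) \<in> S"
    unfolding T(2) \<tau>_def [abs_def] by (rule imageI)
  let ?B = "symmetrize (perm_matrix X \<tau>)"
  have B: "?B x (\<tau> x) = 1" if "x \<in> X" for x
  proof -
    have "perm_matrix X \<tau> x (\<tau> x) = 1" using that \<tau>X by (simp add: perm_matrix_def)
    moreover have "perm_matrix X \<tau> (\<tau> x) x \<in> {0, 1}" by (simp add: perm_matrix_def)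
    \<comment> \<open>The value 2 is excluded afterwards, because \<open>?B\<close> is a class of the scheme.\<close>
    ultimately have "?B x (\<tau> x) \<in> {1, 2}"
      by (auto simp: symmetrize_def matrix_add_def transpose_matrix_def)
    then show ?thesis
      using zero_one_cases [of ?B X x "\<tau> x"] sym scheme_zero_one by auto
  qed
  have "\<tau> (\<tau> x0) = x0"
    using sym
  proof (cases rule: scheme_cases)
    case (twist b)
    then have "\<tau> x0 = twist b x0" using B [OF x0] by (simp add: perm_matrix_def split: if_splits)
    then have "side (\<tau> x0) = side x0" by simp
    then show ?thesis by (simp add: \<tau>_def x0_def)
  next
    case (cross b s)
    then have eq: "\<tau> x = twist b (cross s x)" if "x \<in> X" for x
      using B [OF that] by (simp add: perm_matrix_def split: if_splits)
    show ?thesis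
      using eq [OF \<tau>X [OF x0]] eq [OF x0] x0 cross
      by (simp add: cross_twist cross_cross twist_twist cross_closed)
  next
    case (fibre s)
    then have "side x0 = side (\<tau> x0)" using B [OF x0] by (simp add: fibre_def split: if_splits)
    then show ?thesis by (simp add: \<tau>_def x0_def)
  qed
  moreover have "\<tau> (\<tau> x0) = twist True x0"
  proof -
    have X: "cross t x0 \<in> X" "cross \<one> (cross t x0) \<in> X" "cross \<one> x0 \<in> X" "cross u (cross \<one> x0) \<in> X"
      "cross u x0 \<in> X" "cross \<one> (cross u x0) \<in> X"
      using x0 tu by (simp_all add: cross_closed)
    have "cross t (cross \<one> (cross t x0)) = twist True (cross \<one> x0)"
      using cross_anticommute [OF X(1), of \<one> t] tu x0 by (simp add: cross_cross)
    then have "cross t (\<tau> x0) = cross u (cross \<one> x0)"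
      using cross_anticommute [OF X(2), of u t] tu x0 X
      by (simp add: \<tau>_def cross_twist twist_twist)
    moreover have "cross u (cross \<one> x0) = twist True (cross \<one> (cross u x0))"
      using cross_anticommute [OF x0, of \<one> u] tu by simp
    ultimately have "cross \<one> (cross t (\<tau> x0)) = twist True (cross u x0)"
      using X by (simp add: cross_twist cross_cross)
    then show ?thesis
      using X x0 tu by (simp add: \<tau>_def [of "\<tau> x0"] cross_twist cross_cross)
  qed
  ultimately show False
    using twist_inject [OF x0, of True False] by simp
qed

section \<open>Improperness in order 8\<close>

text \<open>
  With only two crossings there is no obstruction: together with the swap they generate a dihedral
  group of order 8, which acts regularly on the 8 points. Its only elements of order above 2
  are two mutually inverse rotations, and they symmetrize to the single fibre matrix.
\<close>

lemma improper_scheme: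
  assumes "order G = 2"
  shows "improper_jordan_scheme X S"
proof -
  obtain e where e: "carrier G = {\<one>, e}" "e \<noteq> \<one>"
  proof -
    obtain a b where "carrier G = {a, b}" "a \<noteq> b"
      using assms by (auto simp: order_def card_2_iff)
    then show thesis using that one_closed by (metis doubleton_eq_iff insertE singletonD)
  qed
  then have eG: "e \<in> carrier G" by simp
  define rot where "rot b t x = twist b (cross \<one> (cross t x))" for b t x
  define ref where "ref b t x = twist b (cross t x)" for b t x
  define \<Gamma> where "\<Gamma> = {rot b t | b t. t \<in> carrier G} \<union> {ref b t | b t. t \<in> carrier G}"
  have \<Gamma>I: "rot b t \<in> \<Gamma>" "ref b t \<in> \<Gamma>" if "t \<in> carrier G" for b t
    using that unfolding \<Gamma>_def by blast+
  have \<Gamma>_cases: P if "\<pi> \<in> \<Gamma>" "\<And>b t. t \<in> carrier G \<Longrightarrow> \<pi> = rot b t \<Longrightarrow> P"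
      "\<And>b t. t \<in> carrier G \<Longrightarrow> \<pi> = ref b t \<Longrightarrow> P" for \<pi> P
    using that unfolding \<Gamma>_def by blast
  note cl = cross_closed twist_closed one_closed
  note simps = cl cross_twist cross_cross twist_twist
  have maps: "\<pi> x \<in> X" if "\<pi> \<in> \<Gamma>" "x \<in> X" for \<pi> x
    using that(1) by (rule \<Gamma>_cases) (use that(2) in \<open>simp_all add: rot_def ref_def cl\<close>)
  have swap: "cross u (cross t x) = twist (u \<noteq> t) (cross t (cross u x))"
    if "x \<in> X" "t \<in> carrier G" "u \<in> carrier G" for x t u
    using cross_anticommute [OF that] by (cases "u = t") auto
  \<comment> \<open>Closure rests on having only two crossings: a product of two of them can be rewritten so that
    \<open>cross \<one>\<close> comes last.\<close>
  have prod: "\<exists>d s. s \<in> carrier G \<and> (\<forall>x\<in>X. cross u (cross t x) = twist d (cross \<one> (cross s x)))"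
    if t: "t \<in> carrier G" and u: "u \<in> carrier G" for t u
  proof -
    consider "u = \<one>" | "u = t" | "u = e" "t = \<one>" using t u e by auto
    then show ?thesis
    proof cases
      case 1
      then show ?thesis using t by (intro exI [of _ False] exI [of _ t]) simp
    next
      case 2
      then show ?thesis using t by (intro exI [of _ False] exI [of _ \<one>]) (simp add: cross_cross)
    next
      case 3
      then show ?thesis using eG swap [of _ \<one> e] e by (intro exI [of _ True] exI [of _ e]) simp
    qed
  qed
  have closed: "\<exists>\<tau>\<in>\<Gamma>. \<forall>x\<in>X. \<tau> x = \<rho> (\<pi> x)" if "\<pi> \<in> \<Gamma>" "\<rho> \<in> \<Gamma>" for \<pi> \<rho>
    using that(1)
  proof (rule \<Gamma>_cases)
    fix b t assume t: "t \<in> carrier G" and \<pi>: "\<pi> = rot b t"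
    show ?thesis
      using that(2)
    proof (rule \<Gamma>_cases)
      fix c u assume u: "u \<in> carrier G" and \<rho>: "\<rho> = rot c u"
      obtain d s where s: "s \<in> carrier G" "\<forall>x\<in>X. cross u (cross t x) = twist d (cross \<one> (cross s x))"
        using prod t u by blast
      have "\<rho> (\<pi> x) = rot ((c \<noteq> b) \<noteq> ((u \<noteq> \<one>) \<noteq> d)) s x" if "x \<in> X" for x
        using that t u s swap [of "cross t x" \<one> u]
        by (cases b; cases c; cases d; cases "u = \<one>") (simp_all add: \<pi> \<rho> rot_def simps)
      then show ?thesis using \<Gamma>I(1) [OF s(1)] by metis
    next
      fix c u assume u: "u \<in> carrier G" and \<rho>: "\<rho> = ref c u"
      obtain d s where s: "s \<in> carrier G" "\<forall>x\<in>X. cross u (cross t x) = twist d (cross \<one> (cross s x))"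
        using prod t u by blast
      have "\<rho> (\<pi> x) = ref ((c \<noteq> b) \<noteq> ((u \<noteq> \<one>) \<noteq> d)) s x" if "x \<in> X" for x
        using that t u s swap [of "cross t x" \<one> u]
        by (cases b; cases c; cases d; cases "u = \<one>") (simp_all add: \<pi> \<rho> rot_def ref_def simps)
      then show ?thesis using \<Gamma>I(2) [OF s(1)] by metis
    qed
  next
    fix b t assume t: "t \<in> carrier G" and \<pi>: "\<pi> = ref b t"
    show ?thesis
      using that(2)
    proof (rule \<Gamma>_cases)
      fix c u assume u: "u \<in> carrier G" and \<rho>: "\<rho> = rot c u"
      obtain d s where s: "s \<in> carrier G" "\<forall>x\<in>X. cross u (cross t x) = twist d (cross \<one> (cross s x))"
        using prod t u by blast
      have "\<rho> (\<pi> x) = ref ((c \<noteq> b) \<noteq> d) s x" if "x \<in> X" for x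
        using that t u s by (cases b; cases c; cases d) (simp_all add: \<pi> \<rho> rot_def ref_def simps)
      then show ?thesis using \<Gamma>I(2) [OF s(1)] by metis
    next
      fix c u assume u: "u \<in> carrier G" and \<rho>: "\<rho> = ref c u"
      obtain d s where s: "s \<in> carrier G" "\<forall>x\<in>X. cross u (cross t x) = twist d (cross \<one> (cross s x))"
        using prod t u by blast
      have "\<rho> (\<pi> x) = rot ((c \<noteq> b) \<noteq> d) s x" if "x \<in> X" for x
        using that t u s by (cases b; cases c; cases d) (simp_all add: \<pi> \<rho> rot_def ref_def simps)
      then show ?thesis using \<Gamma>I(1) [OF s(1)] by metis
    qed
  qed
  have rot_inverse: "rot (b \<noteq> (t \<noteq> \<one>)) t (rot b t x) = x" if "x \<in> X" "t \<in> carrier G" for b t x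
    using that swap [of "cross t x" \<one> t]
    by (cases b; cases "t = \<one>") (simp_all add: rot_def simps)
  have inverse: "\<exists>\<rho>\<in>\<Gamma>. \<forall>x\<in>X. \<rho> (\<pi> x) = x \<and> \<pi> (\<rho> x) = x" if "\<pi> \<in> \<Gamma>" for \<pi>
    using that
  proof (rule \<Gamma>_cases)
    fix b t assume t: "t \<in> carrier G" and \<pi>: "\<pi> = rot b t"
    have "rot b t (rot (b \<noteq> (t \<noteq> \<one>)) t x) = x" if "x \<in> X" for x
      using rot_inverse [OF that t, of "b \<noteq> (t \<noteq> \<one>)"] by (cases b; cases "t = \<one>") simp_all
    then show ?thesis
      using \<Gamma>I(1) [OF t] rot_inverse t \<pi> by (intro bexI [of _ "rot (b \<noteq> (t \<noteq> \<one>)) t"]) simp_all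
  next
    fix b t assume t: "t \<in> carrier G" and \<pi>: "\<pi> = ref b t"
    show ?thesis
      using \<Gamma>I(2) [OF t] t \<pi> by (intro bexI [of _ "ref b t"]) (simp_all add: ref_def simps)
  qed
  have transitive: "\<exists>\<pi>\<in>\<Gamma>. \<pi> x = y" if xy: "x \<in> X" "y \<in> X" for x y
  proof -
    have c: "pos x \<in> carrier G" "pos y \<in> carrier G" using xy by (auto simp: scheme_points_iff)
    then have xyG: "pos x \<otimes> pos y \<in> carrier G" by simp
    show ?thesis
    proof (cases "side x = side y")
      case True
      have "cross \<one> (cross (pos x \<otimes> pos y) x) \<in> X" using xy xyG by (simp add: cl)
      then obtain b where "y = twist b (cross \<one> (cross (pos x \<otimes> pos y) x))"
        using same_side_twist [of "cross \<one> (cross (pos x \<otimes> pos y) x)" y] xy c True by (auto simp: square_left)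
      then show ?thesis using \<Gamma>I(1) [OF xyG, of b] by (intro bexI) (simp_all add: rot_def)
    next
      case False
      then obtain b where "y = twist b (cross (pos x \<otimes> pos y) x)"
        using other_side_cross [OF xy] by blast
      then show ?thesis using \<Gamma>I(2) [OF xyG, of b] by (intro bexI) (simp_all add: ref_def)
    qed
  qed
  have geom: "side (rot b t x) = side x" "pos (rot b t x) = pos x \<otimes> t \<otimes> \<one>"
      "side (ref b t x) = 1 - side x" "pos (ref b t x) = pos x \<otimes> t" for b t x
    by (simp_all add: rot_def ref_def)
  have semiregular: "\<pi> = \<rho>" if "\<pi> \<in> \<Gamma>" "\<rho> \<in> \<Gamma>" "x \<in> X" "\<pi> x = \<rho> x" for \<pi> \<rho> x
  proof -
    have x: "pos x \<in> carrier G" "1 - side x \<noteq> side x" using \<open>x \<in> X\<close> by (auto simp: scheme_points_iff)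
    note eqs = arg_cong [OF \<open>\<pi> x = \<rho> x\<close>, of side] arg_cong [OF \<open>\<pi> x = \<rho> x\<close>, of pos]
    show ?thesis
      using that(1)
    proof (rule \<Gamma>_cases)
      fix b t assume t: "t \<in> carrier G" and \<pi>: "\<pi> = rot b t"
      show ?thesis
        using that(2)
      proof (rule \<Gamma>_cases)
        fix c u assume u: "u \<in> carrier G" and \<rho>: "\<rho> = rot c u"
        have "t = u" using eqs(2) x t u by (simp add: \<pi> \<rho> geom)
        moreover have "cross \<one> (cross t x) \<in> X" using \<open>x \<in> X\<close> t by (simp add: cl)
        ultimately have "b = c"
          using \<open>\<pi> x = \<rho> x\<close> twist_inject by (simp add: \<pi> \<rho> rot_def)
        then show ?thesis using \<open>t = u\<close> \<pi> \<rho> by simp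
      qed (use eqs(1) x \<pi> in \<open>simp add: geom\<close>)
    next
      fix b t assume t: "t \<in> carrier G" and \<pi>: "\<pi> = ref b t"
      show ?thesis
        using that(2)
      proof (rule \<Gamma>_cases)
        fix c u assume u: "u \<in> carrier G" and \<rho>: "\<rho> = ref c u"
        have "t = u" using eqs(2) x t u by (simp add: \<pi> \<rho> geom)
        moreover have "cross t x \<in> X" using \<open>x \<in> X\<close> t by (simp add: cl)
        ultimately have "b = c"
          using \<open>\<pi> x = \<rho> x\<close> twist_inject by (simp add: \<pi> \<rho> ref_def)
        then show ?thesis using \<open>t = u\<close> \<pi> \<rho> by simp
      qed (use eqs(1) x \<pi> in \<open>simp add: geom\<close>)
    qed
  qed
  have "association_scheme X (perm_matrix X ` \<Gamma>)"
  proof (rule thin_association_scheme)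
    have "\<Gamma> = (\<lambda>(b, t). rot b t) ` (UNIV \<times> carrier G) \<union> (\<lambda>(b, t). ref b t) ` (UNIV \<times> carrier G)"
      unfolding \<Gamma>_def by auto
    then show "finite \<Gamma>" using finite_carrier by simp
    show "X \<noteq> {}" using card_points assms by fastforce
    have "rot False \<one> \<in> \<Gamma>" by (rule \<Gamma>I) simp
    moreover have "\<forall>x\<in>X. rot False \<one> x = x" by (simp add: rot_def cross_cross)
    ultimately show "\<exists>\<pi>\<in>\<Gamma>. \<forall>x\<in>X. \<pi> x = x" by blast
    show "\<forall>y\<in>X. \<pi> y = \<rho> y" if "\<pi> \<in> \<Gamma>" "\<rho> \<in> \<Gamma>" "x \<in> X" "\<pi> x = \<rho> x" for \<pi> \<rho> x
      using semiregular [OF that] by simp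
  qed (rule finite_points maps closed inverse transitive; assumption)+
  moreover have "S = symmetrize ` perm_matrix X ` \<Gamma>"
  proof -
    have ref: "symmetrize (perm_matrix X (ref b t)) = cross_matrix b t" if "t \<in> carrier G" for b t
      using symmetrize_perm_involution [of X "ref b t"] that by (simp add: ref_def [abs_def] simps)
    have one: "symmetrize (perm_matrix X (rot b \<one>)) = twist_matrix b" for b
    proof -
      have "perm_matrix X (rot b \<one>) = twist_matrix b"
        by (rule perm_matrix_cong) (simp add: rot_def cross_cross)
      then show ?thesis using symmetrize_perm_involution [of X "twist b"] by (simp add: simps)
    qed
    have rot: "symmetrize (perm_matrix X (rot b e)) = fibre e" for b
    proof -
      have tr: "transpose_matrix (perm_matrix X (rot b e)) = perm_matrix X (rot (\<not> b) e)"
        using rot_inverse [OF _ eG, of _ b] rot_inverse [OF _ eG, of _ "\<not> b"] maps \<Gamma>I [OF eG] e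
        by (intro transpose_perm_matrix) auto
      define x0 where "x0 = ((0 :: int, \<one>), 0 :: nat)"
      have x0: "x0 \<in> X" by (simp add: x0_def scheme_points_iff)
      have "cross \<one> (cross e x0) \<in> X" using x0 eG by (simp add: cl)
      then have "rot b e x0 \<noteq> rot (\<not> b) e x0"
        by (simp add: rot_def twist_inject)
      then have "perm_matrix X (rot b e) \<noteq> perm_matrix X (rot (\<not> b) e)"
        using perm_matrix_eqD [of X "rot b e" "rot (\<not> b) e", OF _ x0 maps [OF \<Gamma>I(1) [OF eG] x0]] by blast
      then have "symmetrize (perm_matrix X (rot b e)) =
          matrix_add (perm_matrix X (rot b e)) (perm_matrix X (rot (\<not> b) e))"
        using tr by (simp add: symmetrize_def)
      also have "\<dots> = fibre e"
      proof (rule matrices_eqI)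
        show "matrix_add (perm_matrix X (rot b e)) (perm_matrix X (rot (\<not> b) e)) \<in> matrices X"
          unfolding matrix_add_def by (intro add_in_matrices perm_in_matrices)
        show "fibre e \<in> matrices X" by (rule fibre_in_matrices)
        fix x y assume xy: "x \<in> X" "y \<in> X"
        have "cross \<one> (cross e x) \<in> X" using xy eG by (simp add: cl)
        moreover have "side (cross \<one> (cross e x)) = side x" "pos (cross \<one> (cross e x)) = pos x \<otimes> e"
          using xy eG by (simp_all add: scheme_points_iff)
        ultimately show "matrix_add (perm_matrix X (rot b e)) (perm_matrix X (rot (\<not> b) e)) x y = fibre e x y"
          using twist_pair_fibre [OF xy, of "cross \<one> (cross e x)" e b]
          by (simp only: matrix_add_def perm_matrix_def rot_def xy simp_thms if_True)
      qed
      finally show ?thesis .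
    qed
    show ?thesis
    proof (intro subset_antisym subsetI)
      fix A assume "A \<in> S"
      then show "A \<in> symmetrize ` perm_matrix X ` \<Gamma>"
      proof (cases rule: scheme_cases)
        case (twist b)
        then show ?thesis unfolding one [symmetric] by (simp add: \<Gamma>I)
      next
        case (cross b t)
        then show ?thesis using ref [OF cross(1), symmetric] by (simp add: \<Gamma>I)
      next
        case (fibre t)
        then have "A = symmetrize (perm_matrix X (rot False e))" using e rot by auto
        then show ?thesis using \<Gamma>I(1) [OF eG] by blast
      qed
    next
      fix A assume "A \<in> symmetrize ` perm_matrix X ` \<Gamma>"
      then obtain \<pi> where \<pi>: "\<pi> \<in> \<Gamma>" "A = symmetrize (perm_matrix X \<pi>)" by blast
      from \<pi>(1) show "A \<in> S"
      proof (rule \<Gamma>_cases)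
        fix b t assume t: "t \<in> carrier G" and r: "\<pi> = rot b t"
        show ?thesis
        proof (cases "t = \<one>")
          case True
          then show ?thesis using one r \<pi> scheme_members(1) by simp
        next
          case False
          then have "t = e" using t e by auto
          then show ?thesis using rot r \<pi> scheme_members(3) [OF eG e(2)] by simp
        qed
      next
        fix b t assume t: "t \<in> carrier G" and r: "\<pi> = ref b t"
        then show ?thesis using ref [OF t] r \<pi> scheme_members(2) [OF t] by simp
      qed
    qed
  qed
  ultimately show ?thesis
    unfolding improper_jordan_scheme_def using scheme_is_jordan by blast
qed

end

section \<open>Uniqueness up to combinatorial isomorphism\<close>

lemma (in admissible) scheme_nonzero: "(\<lambda>x y. 0) \<notin> S"
proof
  define x0 where "x0 = ((0 :: int, \<one>), 0 :: nat)"
  have x0: "x0 \<in> X" by (simp add: x0_def scheme_points_iff)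
  assume "(\<lambda>x y. 0) \<in> S"
  then show False
  proof (cases rule: scheme_cases)
    case (twist b)
    then show False
      using fun_cong [OF fun_cong [OF twist, of x0], of "twist b x0"] x0
      by (simp add: perm_matrix_def twist_closed)
  next
    case (cross b t)
    then show False
      using fun_cong [OF fun_cong [OF cross(2), of x0], of "twist b (cross t x0)"] x0
      by (simp add: perm_matrix_def twist_closed cross_closed)
  next
    case (fibre t)
    have "((0, t), 0) \<in> X" using fibre by (simp add: scheme_points_iff)
    then show False
      using fun_cong [OF fun_cong [OF fibre(3), of x0], of "((0, t), 0)"] x0 fibre
      by (simp add: fibre_def x0_def)
  qed
qed

text \<open>
  The quotient of the two sign matrices is \<open>u x \<cdot> v a \<cdot> w (x \<otimes> a)\<close>. The factors \<open>u\<close> and \<open>v\<close> are absorbed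
  by swapping fibres on the two sides, and \<open>w\<close> by exchanging \<open>cross_matrix False t\<close> with
  \<open>cross_matrix True t\<close> when \<open>w t\<close> holds.
\<close>

theorem schemes_isomorphic:
  fixes G :: "('a, 'm) monoid_scheme" and G' :: "('b, 'n) monoid_scheme"
  assumes "admissible G M" "admissible G' M'" "order G = order G'"
  shows "combinatorially_isomorphic (scheme_points G) (scheme_matrices G M)
    (scheme_points G') (scheme_matrices G' M')"
proof -
  interpret A: admissible G M by fact
  interpret B: admissible G' M' by fact
  obtain f where f: "bij_betw f (carrier G) (carrier G')"
    and f_mult: "\<forall>x\<in>carrier G. \<forall>y\<in>carrier G. f (x \<otimes>\<^bsub>G\<^esub> y) = f x \<otimes>\<^bsub>G'\<^esub> f y"
    by (rule elementary_2_group_iso [OF A.elementary_2_group_axioms B.elementary_2_group_axioms assms(3)])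
  have hom: "f (x \<otimes>\<^bsub>G\<^esub> y) = f x \<otimes>\<^bsub>G'\<^esub> f y" if "x \<in> carrier G" "y \<in> carrier G" for x y
    using f_mult that by blast
  have fc: "f x \<in> carrier G'" if "x \<in> carrier G" for x
    using f that by (auto simp: bij_betw_def)
  have f_inj: "f x = f y \<longleftrightarrow> x = y" if "x \<in> carrier G" "y \<in> carrier G" for x y
    using f that by (auto simp: bij_betw_def inj_on_def)
  have "f \<one>\<^bsub>G\<^esub> \<otimes>\<^bsub>G'\<^esub> f \<one>\<^bsub>G\<^esub> = f \<one>\<^bsub>G\<^esub>" using hom [of "\<one>\<^bsub>G\<^esub>" "\<one>\<^bsub>G\<^esub>"] by simp
  then have f_one: "f \<one>\<^bsub>G\<^esub> = \<one>\<^bsub>G'\<^esub>" using B.square fc by simp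
  define D where "D x a \<longleftrightarrow> A.neg x a \<noteq> B.neg (f x) (f a)" for x a
  have "A.second_difference False D"
    unfolding A.second_difference_def
  proof (intro ballI impI)
    fix x a d assume c: "x \<in> carrier G" "a \<in> carrier G" "d \<in> carrier G"
    show "((D x a \<noteq> D x (a \<otimes>\<^bsub>G\<^esub> d)) \<noteq> (D (x \<otimes>\<^bsub>G\<^esub> d) a \<noteq> D (x \<otimes>\<^bsub>G\<^esub> d) (a \<otimes>\<^bsub>G\<^esub> d))) = False"
    proof (cases "d = \<one>\<^bsub>G\<^esub>")
      case True
      then show ?thesis using c by simp
    next
      case False
      then have "f d \<noteq> \<one>\<^bsub>G'\<^esub>" using f_inj [of d "\<one>\<^bsub>G\<^esub>"] f_one c by simp
      then have "(B.neg (f x) (f a) \<noteq> B.neg (f x) (f (a \<otimes>\<^bsub>G\<^esub> d))) \<noteq>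
          (B.neg (f (x \<otimes>\<^bsub>G\<^esub> d)) (f a) \<noteq> B.neg (f (x \<otimes>\<^bsub>G\<^esub> d)) (f (a \<otimes>\<^bsub>G\<^esub> d)))"
        using B.second_difference_neg [unfolded B.second_difference_def, rule_format, of "f x" "f a" "f d"] fc c
        by (simp add: hom)
      moreover have "(A.neg x a \<noteq> A.neg x (a \<otimes>\<^bsub>G\<^esub> d)) \<noteq>
          (A.neg (x \<otimes>\<^bsub>G\<^esub> d) a \<noteq> A.neg (x \<otimes>\<^bsub>G\<^esub> d) (a \<otimes>\<^bsub>G\<^esub> d))"
        using A.second_difference_neg [unfolded A.second_difference_def, rule_format, of x a d] c False by simp
      ultimately show ?thesis unfolding D_def by argo
    qed
  qed
  then obtain u v w :: "'a \<Rightarrow> bool" where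
    coboundary: "\<forall>x\<in>carrier G. \<forall>a\<in>carrier G. D x a \<longleftrightarrow> (u x \<noteq> v a) \<noteq> w (x \<otimes>\<^bsub>G\<^esub> a)"
    by (rule A.second_difference_coboundary)
  have uvw: "D x a \<longleftrightarrow> (u x \<noteq> v a) \<noteq> w (x \<otimes>\<^bsub>G\<^esub> a)" if "x \<in> carrier G" "a \<in> carrier G" for x a
    by (rule coboundary [THEN bspec, OF that(1), THEN bspec, OF that(2)])
  define F where "F x = twist (if side x = 0 then u (pos x) else v (pos x)) ((side x, f (pos x)), snd x)"
    for x :: "(int \<times> 'a) \<times> nat"
  have F_simps: "side (F x) = side x" "pos (F x) = f (pos x)" for x
    by (simp_all add: F_def)
  have F_closed: "F x \<in> B.X" if "x \<in> A.X" for x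
    unfolding F_def by (rule B.twist_closed) (use that fc in \<open>simp add: scheme_points_iff\<close>)
  have F_twist: "F (twist b x) = twist b (F x)" if "x \<in> A.X" for b x
    using that by (cases b) (auto simp: F_def twist_def swap_def scheme_points_iff)
  \<comment> \<open>Both sides lie over the same position; their last coordinates agree by \<open>uvw\<close>, read with the row
    on side 0.\<close>
  have F_cross: "F (A.cross t x) = twist (w t) (B.cross (f t) (F x))" if x: "x \<in> A.X" and t: "t \<in> carrier G" for t x
  proof -
    obtain s g i where xeq: "x = ((s, g), i)" by (metis surj_pair)
    have g: "g \<in> carrier G" "s = 0 \<or> s = 1" "i = 0 \<or> i = 1"
      using x by (auto simp: xeq scheme_points_iff)
    have gt: "g \<otimes>\<^bsub>G\<^esub> t \<in> carrier G" "g \<otimes>\<^bsub>G\<^esub> (g \<otimes>\<^bsub>G\<^esub> t) = t" "g \<otimes>\<^bsub>G\<^esub> t \<otimes>\<^bsub>G\<^esub> g = t"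
      using g t by (simp_all add: A.ac)
    have p0: "A.neg g (g \<otimes>\<^bsub>G\<^esub> t) \<noteq> B.neg (f g) (f (g \<otimes>\<^bsub>G\<^esub> t)) \<longleftrightarrow> (u g \<noteq> v (g \<otimes>\<^bsub>G\<^esub> t)) \<noteq> w t"
      using uvw [OF g(1) gt(1)] gt by (simp add: D_def)
    have p1: "A.neg (g \<otimes>\<^bsub>G\<^esub> t) g \<noteq> B.neg (f (g \<otimes>\<^bsub>G\<^esub> t)) (f g) \<longleftrightarrow> (u (g \<otimes>\<^bsub>G\<^esub> t) \<noteq> v g) \<noteq> w t"
      using uvw [OF gt(1) g(1)] gt by (simp add: D_def)
    have h: "f g \<otimes>\<^bsub>G'\<^esub> f t = f (g \<otimes>\<^bsub>G\<^esub> t)" using hom g t by simp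
    show ?thesis
      using g(2)
    proof
      assume s: "s = 0"
      show ?thesis
        using p0 g(3)
        by (cases "u g"; cases "v (g \<otimes>\<^bsub>G\<^esub> t)"; cases "w t"; cases "A.neg g (g \<otimes>\<^bsub>G\<^esub> t)")
          (auto simp: s xeq F_def A.cross_def B.cross_def h twist_def swap_def)
    next
      assume s: "s = 1"
      show ?thesis
        using p1 g(3)
        by (cases "v g"; cases "u (g \<otimes>\<^bsub>G\<^esub> t)"; cases "w t"; cases "A.neg (g \<otimes>\<^bsub>G\<^esub> t) g")
          (auto simp: s xeq F_def A.cross_def B.cross_def h twist_def swap_def)
    qed
  qed
  have F_inj: "x = y" if xy: "x \<in> A.X" "y \<in> A.X" "F x = F y" for x y
  proof -
    have c: "pos x \<in> carrier G" "pos y \<in> carrier G" using xy by (simp_all add: scheme_points_iff)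
    have "side x = side y" "f (pos x) = f (pos y)"
      using arg_cong [OF xy(3), of side] arg_cong [OF xy(3), of pos] by (simp_all only: F_simps)
    then obtain b where b: "y = twist b x" using A.same_side_twist [OF xy(1,2)] f_inj [OF c] by blast
    then have "twist b (F x) = twist False (F x)" using xy F_twist [OF xy(1), of b] by simp
    then show ?thesis using b B.twist_inject [OF F_closed [OF xy(1)], of b False] by simp
  qed
  have F_bij: "bij_betw F A.X B.X"
  proof -
    have inj: "inj_on F A.X" using F_inj by (auto simp: inj_on_def)
    have "F ` A.X = B.X"
      by (rule card_subset_eq)
        (use F_closed in \<open>auto simp: B.finite_points card_image [OF inj] A.card_points B.card_points assms(3)\<close>)
    then show ?thesis using inj by (simp add: bij_betw_def)
  qed
  have perm: "perm_matrix A.X \<pi> x y = perm_matrix B.X \<rho> (F x) (F y)"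
    if xy: "x \<in> A.X" "y \<in> A.X" "\<pi> x \<in> A.X" "F (\<pi> x) = \<rho> (F x)" for \<pi> \<rho> x y
  proof -
    have "y = \<pi> x \<longleftrightarrow> F y = \<rho> (F x)" using F_inj [OF xy(2,3)] xy(4) by metis
    then show ?thesis
      using F_closed [OF xy(1)] F_closed [OF xy(2)] xy(1,2) by (simp add: perm_matrix_def)
  qed
  show ?thesis
  proof (rule combinatorially_isomorphicI [OF A.scheme_partition B.scheme_partition B.scheme_nonzero F_bij])
    fix C assume "C \<in> A.S"
    then show "\<exists>C'\<in>B.S. \<forall>x\<in>A.X. \<forall>y\<in>A.X. C x y = C' (F x) (F y)"
    proof (cases rule: A.scheme_cases)
      case (twist b)
      show ?thesis
        unfolding twist
        by (intro bexI [OF _ B.scheme_members(1) [of b]] ballI perm)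
          (simp_all add: A.twist_closed F_twist)
    next
      case (cross b t)
      show ?thesis
        unfolding cross(2)
        by (intro bexI [OF _ B.scheme_members(2) [OF fc [OF cross(1)], of "b \<noteq> w t"]] ballI perm)
          (simp_all add: A.twist_closed A.cross_closed cross F_twist F_cross B.twist_twist B.cross_closed F_closed fc)
    next
      case (fibre t)
      have "f t \<noteq> \<one>\<^bsub>G'\<^esub>" using f_inj [of t "\<one>\<^bsub>G\<^esub>"] f_one fibre by simp
      show ?thesis
        unfolding fibre(3)
      proof (intro bexI [OF _ B.scheme_members(3) [OF fc [OF fibre(1)] \<open>f t \<noteq> \<one>\<^bsub>G'\<^esub>\<close>]] ballI)
        fix x y assume xy: "x \<in> A.X" "y \<in> A.X"
        have "pos x \<in> carrier G" "pos y \<in> carrier G" using xy by (auto simp: scheme_points_iff)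
        then have "f (pos y) = f (pos x) \<otimes>\<^bsub>G'\<^esub> f t \<longleftrightarrow> pos y = pos x \<otimes>\<^bsub>G\<^esub> t"
          using fibre(1) f_inj [of "pos y" "pos x \<otimes>\<^bsub>G\<^esub> t"] by (simp add: hom)
        then show "A.fibre t x y = B.fibre (f t) (F x) (F y)"
          using xy by (simp add: A.fibre_def B.fibre_def F_closed F_simps)
      qed
    qed
  qed
qed

section \<open>Octonion signs\<close>

definition xor_group :: "nat \<Rightarrow> nat monoid" where
  "xor_group k = \<lparr>carrier = {..<2 ^ k}, monoid.mult = semiring_bit_operations_class.xor, one = 0\<rparr>"

text \<open>
  The exponent of the sign in the octonions as a twisted group algebra of \<open>(\<int>/2)\<^sup>3\<close>: the quadratic
  part \<open>\<Sum>i\<le>j. x\<^sub>i a\<^sub>j\<close> plus the cubic terms that make the algebra non-associative. On the first one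
  or two coordinates it gives the complex numbers and the quaternions.
\<close>

definition octonion_neg :: "bool \<Rightarrow> bool \<Rightarrow> bool \<Rightarrow> bool \<Rightarrow> bool \<Rightarrow> bool \<Rightarrow> bool" where
  "octonion_neg x0 x1 x2 a0 a1 a2 \<longleftrightarrow>
     ((((x0 \<and> a0) \<noteq> (x0 \<and> a1)) \<noteq> ((x0 \<and> a2) \<noteq> (x1 \<and> a1))) \<noteq> ((x1 \<and> a2) \<noteq> (x2 \<and> a2))) \<noteq>
     (((a0 \<and> x1 \<and> x2) \<noteq> (x0 \<and> a1 \<and> x2)) \<noteq> (x0 \<and> x1 \<and> a2))"

lemma octonion_neg_difference:
  assumes "x0 \<noteq> y0 \<or> x1 \<noteq> y1 \<or> x2 \<noteq> y2"
  shows "(octonion_neg x0 x1 x2 (x0 \<noteq> z0) (x1 \<noteq> z1) (x2 \<noteq> z2) \<noteq>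
      octonion_neg x0 x1 x2 (y0 \<noteq> z0) (y1 \<noteq> z1) (y2 \<noteq> z2)) \<noteq>
    (octonion_neg y0 y1 y2 (x0 \<noteq> z0) (x1 \<noteq> z1) (x2 \<noteq> z2) \<noteq>
      octonion_neg y0 y1 y2 (y0 \<noteq> z0) (y1 \<noteq> z1) (y2 \<noteq> z2))"
  using assms
  by (cases x0; cases x1; cases x2; cases y0; cases y1; cases y2; cases z0; cases z1; cases z2;
      simp only: octonion_neg_def simp_thms)

definition octonion_sign :: "nat \<Rightarrow> nat \<Rightarrow> int" where
  "octonion_sign x a =
     (if octonion_neg (bit x 0) (bit x 1) (bit x 2) (bit a 0) (bit a 1) (bit a 2) then -1 else 1)"

lemma xor_less_power:
  fixes x y :: nat
  assumes "x < 2 ^ k" "y < 2 ^ k"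
  shows "semiring_bit_operations_class.xor x y < 2 ^ k"
proof -
  have "take_bit k (semiring_bit_operations_class.xor x y) = semiring_bit_operations_class.xor x y"
    using assms by (simp add: take_bit_xor take_bit_nat_eq_self)
  then show ?thesis by (simp only: take_bit_nat_eq_self_iff)
qed

lemma xor_group_elementary: "elementary_2_group (xor_group k)"
proof -
  have "comm_group (xor_group k)"
  proof (rule comm_groupI)
    fix x assume "x \<in> carrier (xor_group k)"
    then show "\<exists>y\<in>carrier (xor_group k). y \<otimes>\<^bsub>xor_group k\<^esub> x = \<one>\<^bsub>xor_group k\<^esub>"
      by (intro bexI [of _ x]) (simp_all add: xor_group_def)
  qed (simp_all add: xor_group_def xor_less_power ac_simps)
  then show ?thesis
    unfolding elementary_2_group_def elementary_2_group_axioms_def by (simp add: xor_group_def)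
qed

lemma octonion_admissible:
  assumes "k \<in> {1, 2, 3}"
  shows "admissible (xor_group k) octonion_sign"
proof -
  interpret elementary_2_group "xor_group k" by (rule xor_group_elementary)
  have k: "(2 :: nat) ^ k \<le> 8" using assms by auto
  show ?thesis
  proof
    show "carrier (xor_group k) \<noteq> {\<one>\<^bsub>xor_group k\<^esub>}"
    proof
      assume "carrier (xor_group k) = {\<one>\<^bsub>xor_group k\<^esub>}"
      then have "card {..<(2 :: nat) ^ k} = card {0 :: nat}" by (simp add: xor_group_def)
      then show False using assms by auto
    qed
    show "octonion_sign x y \<in> {1, -1}" for x y
      by (simp add: octonion_sign_def Let_def)
    fix x y z assume c: "x \<in> carrier (xor_group k)" "y \<in> carrier (xor_group k)" "z \<in> carrier (xor_group k)"
      and "x \<noteq> y"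
    have bits: "\<not> bit x n" "\<not> bit y n" if "3 \<le> n" for n
    proof -
      have "x < 2 ^ 3" "y < 2 ^ 3" using c k by (auto simp: xor_group_def)
      then have "take_bit 3 x = x" "take_bit 3 y = y" by (simp_all add: take_bit_nat_eq_self)
      then show "\<not> bit x n" "\<not> bit y n" using that by (metis bit_take_bit_iff not_less)+
    qed
    have ne: "bit x 0 \<noteq> bit y 0 \<or> bit x 1 \<noteq> bit y 1 \<or> bit x 2 \<noteq> bit y 2"
    proof (rule ccontr)
      assume "\<not> ?thesis"
      then have "bit x n = bit y n" for n
        using bits [of n] by (cases "n = 0 \<or> n = 1 \<or> n = 2") auto
      then show False using \<open>x \<noteq> y\<close> by (simp add: bit_eq_iff)
    qed
    show "octonion_sign x (x \<otimes>\<^bsub>xor_group k\<^esub> z) * octonion_sign x (y \<otimes>\<^bsub>xor_group k\<^esub> z) *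
        octonion_sign y (x \<otimes>\<^bsub>xor_group k\<^esub> z) * octonion_sign y (y \<otimes>\<^bsub>xor_group k\<^esub> z) = -1"
      using octonion_neg_difference [OF ne, of "bit z 0" "bit z 1" "bit z 2"]
      by (auto simp: octonion_sign_def xor_group_def bit_xor_iff split: if_splits)
  qed
qed

lemma admissible_exists:
  assumes "n \<in> {2, 4, 8}"
  shows "\<exists>(G :: nat monoid) M. admissible_pair G M \<and> order G = n"
proof -
  obtain k :: nat where k: "k \<in> {1, 2, 3}" "n = 2 ^ k"
  proof -
    have "n = 2 ^ 1 \<or> n = 2 ^ 2 \<or> n = 2 ^ 3" using assms by auto
    then show thesis using that by blast
  qed
  have "order (xor_group k) = n" by (simp add: order_def xor_group_def k)
  then show ?thesis
    using octonion_admissible [OF k(1)] admissible_pair_iff by blast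
qed

section \<open>Counting isomorphism classes\<close>

text \<open>
  The relation is taken on arbitrary families of functions, where it need not be symmetric because
  relabelling discards values outside the point set; for the pair in question symmetry is a hypothesis.
\<close>

lemma isomorphism_class_eq_iff:
  assumes "S \<subseteq> matrices X" "S' \<subseteq> matrices Y"
    and "combinatorially_isomorphic X S Y S' \<Longrightarrow> combinatorially_isomorphic Y S' X S"
  shows "combinatorial_isomorphism_rel `` {(X, S)} = combinatorial_isomorphism_rel `` {(Y, S')} \<longleftrightarrow>
    combinatorially_isomorphic X S Y S'"
proof
  assume "combinatorial_isomorphism_rel `` {(X, S)} = combinatorial_isomorphism_rel `` {(Y, S')}"
  moreover have "(Y, S') \<in> combinatorial_isomorphism_rel `` {(Y, S')}"
    using combinatorially_isomorphic_refl [OF assms(2)] by (simp add: combinatorial_isomorphism_rel_def)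
  ultimately have "(Y, S') \<in> combinatorial_isomorphism_rel `` {(X, S)}" by simp
  then show "combinatorially_isomorphic X S Y S'" by (simp add: combinatorial_isomorphism_rel_def)
next
  assume iso: "combinatorially_isomorphic X S Y S'"
  have "combinatorially_isomorphic X S Z U \<longleftrightarrow> combinatorially_isomorphic Y S' Z U" for Z U
    using iso assms(3) [OF iso] combinatorially_isomorphic_trans by blast
  then show "combinatorial_isomorphism_rel `` {(X, S)} = combinatorial_isomorphism_rel `` {(Y, S')}"
    by (auto simp: combinatorial_isomorphism_rel_def)
qed

lemma arising_class_iff:
  assumes "(X, S) \<in> arising_schemes" "(Y, S') \<in> arising_schemes"
  shows "combinatorial_isomorphism_rel `` {(X, S)} = combinatorial_isomorphism_rel `` {(Y, S')} \<longleftrightarrow>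
    card X = card Y"
proof -
  obtain G :: "nat monoid" and M where G: "admissible G M" "X = scheme_points G" "S = scheme_matrices G M"
    using assms(1) unfolding arising_schemes_def admissible_pair_iff by blast
  obtain G' :: "nat monoid" and M' where G': "admissible G' M'" "Y = scheme_points G'" "S' = scheme_matrices G' M'"
    using assms(2) unfolding arising_schemes_def admissible_pair_iff by blast
  have "card X = card Y \<longleftrightarrow> order G = order G'"
    using admissible.card_points [OF G(1)] admissible.card_points [OF G'(1)] G G' by simp
  then have iso: "combinatorially_isomorphic X S Y S' \<longleftrightarrow> card X = card Y"
      "combinatorially_isomorphic Y S' X S \<longleftrightarrow> card X = card Y"
    using schemes_isomorphic [OF G(1) G'(1)] schemes_isomorphic [OF G'(1) G(1)] G(2,3) G'(2,3)
      combinatorially_isomorphic_card [of X S Y S'] combinatorially_isomorphic_card [of Y S' X S] by auto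
  have "S \<subseteq> matrices X" "S' \<subseteq> matrices Y"
    using admissible.scheme_zero_one [OF G(1)] admissible.scheme_zero_one [OF G'(1)] G G' zero_one_in_matrices by blast+
  then show ?thesis
    using isomorphism_class_eq_iff [of S X S' Y] iso by simp
qed

lemma (in admissible) order_values: "order G \<in> {2, 4, 8}"
  by (rule order_cases [OF second_difference_neg nontrivial])

lemma arising_orders: "(\<lambda>(X, S). card X) ` arising_schemes = {8, 16, 32}"
proof (intro subset_antisym subsetI)
  fix n assume "n \<in> (\<lambda>(X, S). card X) ` arising_schemes"
  then obtain G :: "nat monoid" and M where G: "admissible G M" "n = card (scheme_points G)"
    unfolding arising_schemes_def admissible_pair_iff by auto
  then show "n \<in> {8, 16, 32}"
    using admissible.order_values [OF G(1)] admissible.card_points [OF G(1)] by auto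
next
  fix n :: nat assume "n \<in> {8, 16, 32}"
  then have k: "n div 4 \<in> {2, 4, 8}" "n = 4 * (n div 4)" by auto
  from admissible_exists [OF k(1)] obtain G :: "nat monoid" and M
    where G: "admissible_pair G M" "order G = n div 4" by (elim exE conjE)
  have "n = card (scheme_points G)"
    using admissible.card_points [OF G(1) [unfolded admissible_pair_iff]] G(2) k(2) by simp
  moreover have "(scheme_points G, scheme_matrices G M) \<in> arising_schemes"
    using G unfolding arising_schemes_def by blast
  ultimately show "n \<in> (\<lambda>(X, S). card X) ` arising_schemes"
    by (intro image_eqI [of _ _ "(scheme_points G, scheme_matrices G M)"]) simp_all
qed

lemma card_arising_classes: "card (arising_schemes // combinatorial_isomorphism_rel) = 3"
proof -
  define size where "size p = card (fst p)"
    for p :: "((int \<times> nat) \<times> nat) set \<times> ((int \<times> nat) \<times> nat) cmatrix set"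
  define cls where "cls p = combinatorial_isomorphism_rel `` {p}"
    for p :: "((int \<times> nat) \<times> nat) set \<times> ((int \<times> nat) \<times> nat) cmatrix set"
  have iff: "cls p = cls q \<longleftrightarrow> size p = size q" if "p \<in> arising_schemes" "q \<in> arising_schemes" for p q
    using arising_class_iff [of "fst p" "snd p" "fst q" "snd q"] that by (simp add: cls_def size_def)
  have sizes: "size ` arising_schemes = {8, 16, 32}"
    using arising_orders by (simp add: size_def [abs_def] case_prod_unfold)
  define rep where "rep n = (SOME p. p \<in> arising_schemes \<and> size p = n)" for n
  have rep: "rep (size p) \<in> arising_schemes \<and> size (rep (size p)) = size p" if "p \<in> arising_schemes" for p
    unfolding rep_def by (rule someI [of _ p]) (simp add: that)
  have "arising_schemes // combinatorial_isomorphism_rel = cls ` arising_schemes"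
    by (auto simp: quotient_def cls_def)
  also have "\<dots> = (\<lambda>n. cls (rep n)) ` size ` arising_schemes"
    unfolding image_image using rep iff by (intro image_cong) auto
  finally have "arising_schemes // combinatorial_isomorphism_rel = (\<lambda>n. cls (rep n)) ` size ` arising_schemes" .
  moreover have "inj_on (\<lambda>n. cls (rep n)) (size ` arising_schemes)"
    using rep iff by (auto simp: inj_on_def)
  ultimately have "card (arising_schemes // combinatorial_isomorphism_rel) = card (size ` arising_schemes)"
    by (simp add: card_image)
  then show ?thesis by (simp add: sizes)
qed

theorem mainTheorem3:
  shows
    "card (arising_schemes // combinatorial_isomorphism_rel) = 3 \<and>
     (\<lambda>(X, S). card X) ` arising_schemes = {8, 16, 32} \<and>
     (\<forall>n\<in>{2, 4, 8}. \<exists>(G :: nat monoid) M. admissible_pair G M \<and> order G = n) \<and>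
     (\<forall>(G :: 'a monoid) M. admissible_pair G M \<longrightarrow>
        order G \<in> {2, 4, 8} \<and>
        card (scheme_points G) = 4 * order G \<and>
        (order G = 2 \<longrightarrow> improper_jordan_scheme (scheme_points G) (scheme_matrices G M)) \<and>
        (order G \<in> {4, 8} \<longrightarrow> proper_jordan_scheme (scheme_points G) (scheme_matrices G M))) \<and>
     (\<forall>(G :: 'a monoid) M (G' :: 'b monoid) M'.
        admissible_pair G M \<and> admissible_pair G' M' \<and> order G = order G' \<longrightarrow>
        combinatorially_isomorphic (scheme_points G) (scheme_matrices G M)
          (scheme_points G') (scheme_matrices G' M'))"
proof (intro conjI allI impI)
  show "card (arising_schemes // combinatorial_isomorphism_rel) = 3"
    by (rule card_arising_classes)
  show "(\<lambda>(X, S). card X) ` arising_schemes = {8, 16, 32}"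
    by (rule arising_orders)
  show "\<forall>n\<in>{2, 4, 8}. \<exists>(G :: nat monoid) M. admissible_pair G M \<and> order G = n"
    using admissible_exists by (intro ballI)
next
  fix G :: "'a monoid" and M
  assume "admissible_pair G M"
  then interpret admissible G M by (simp add: admissible_pair_iff)
  show "order G \<in> {2, 4, 8}" by (rule order_values)
  show "card (scheme_points G) = 4 * order G" by (rule card_points)
  show "improper_jordan_scheme (scheme_points G) (scheme_matrices G M)" if "order G = 2"
    using that by (rule improper_scheme)
  show "proper_jordan_scheme (scheme_points G) (scheme_matrices G M)" if "order G \<in> {4, 8}"
    using that by (rule proper_scheme)
next
  fix G :: "'a monoid" and M and G' :: "'b monoid" and M'
  assume "admissible_pair G M \<and> admissible_pair G' M' \<and> order G = order G'"
  then show "combinatorially_isomorphic (scheme_points G) (scheme_matrices G M)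
      (scheme_points G') (scheme_matrices G' M')"
    by (intro schemes_isomorphic) (simp_all add: admissible_pair_iff)
qed

end
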